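(* Let $M$ be the one-relator monoid defined by the monoid presentation $\langle A\mid r=1\rangle$. Write $r\equiv r_1r_2\cdots r_k$ where each $r_i\in A^+=A^*\setminus\{1\}$, each $r_i$ represents an invertible element of $M$, and no proper non-empty prefix of $r_i$ represents an invertible element of $M$ ($1\le i\le k$). Set $\Delta=\{r_i\mid 1\le i\le k\}$. Suppose that: (C1) no word from $\Delta$ is a proper subword of any other word from $\Delta$, and (C2) there exist distinct words $\gamma,\delta\in\Delta$ with a common first letter $a$. Then there exist a free monoid $D$ of finite rank $n\ge 2$ and a tuple of positive integer weights $\vec\lambda=(\lambda_1,\dots,\lambda_n)$ such that the free monoid with weighted length relation $(D,\cdot,1,=,\mathsf{L}_{\vec\lambda})$ is interpretable in $M$ by systems of equations. Consequently, the problem of solving systems of word equations with $\vec\lambda$-weighted length constraints (that is, the Diophantine problem in $(D,\cdot,1,=,\mathsf{L}_{\vec\lambda})$) is reducible to the problem of solving systems of equations in $M$. If in addition to (C1) and (C2) we have: (C3) no word in $\Delta$ starts with $a^2$, then there exists a free monoid $D$ of finite rank $n\ge 2$ such that the free monoid with length relation $(D,\cdot,1,=,\mathsf{L})$ is interpretable in $M$ by systems of equations, where $\mathsf{L}$ is the standard length relation, i.e. $\mathsf{L}(u,v)$ if and only if $|u|\le|v|$ for $u,v\in D$. Consequently, in this case, the problem of solving systems of word equations with length constraints (that is, the Diophantine problem in $(D,\cdot,1,=,\mathsf{L})$) is reducible to the problem of solving systems of equations in $M$.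
   Context: $A$ is a finite alphabet, $A^*$ is the free monoid on $A$, and $u\equiv v$ means equality as words. The decomposition $r\equiv r_1\cdots r_k$ in the statement exists and is unique; the $r_i$ are the minimal invertible pieces of $r$. Weighted length: for a free monoid $D$ freely generated by $d_1,\dots,d_n$ and $\vec\lambda=(\lambda_1,\dots,\lambda_n)$, put $|w|_{\vec\lambda}=\sum_i\lambda_i|w|_{d_i}$, where $|w|_{d_i}$ is the number of occurrences of $d_i$ in $w$; $\mathsf{L}_{\vec\lambda}(u,v)$ holds iff $|u|_{\vec\lambda}\le|v|_{\vec\lambda}$. When all weights are $1$, one gets the usual length $|\cdot|$ and the relation $\mathsf{L}$. Equations: in a structure $S$, an equation is an atomic formula in the language of $S$ with coefficients (constants) from the domain of $S$ allowed; a system of equations is a finite conjunction of equations. Monoids are considered in the language $(\cdot,1,=)$. In $(D,\cdot,1,=,\mathsf{L}_{\vec\lambda})$ a system of equations is a finite system of word equations together with finitely many constraints $\mathsf{L}_{\vec\lambda}(w_1,w_2)$, where $w_1,w_2$ are words in variables and constants. The Diophantine problem in $S$ is the algorithmic problem of deciding whether a given system of equations in $S$ (with coefficients from a fixed computable set; in a monoid generated by $A$ coefficients are given by words over $A$) has a solution. A problem $P_1$ is reducible to $P_2$ if there is an algorithm solving $P_1$ using an oracle for $P_2$. A set $S\subseteq M^n$ is e-definable in a structure $M$ if there is a system of equations $\Sigma(\vec x,\vec y)$ such that for all $\vec m\in M^n$: $\vec m\in S$ iff $\Sigma(\vec m,\vec y_0)$ holds in $M$ for some tuple $\vec y_0$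 of elements of $M$. A structure $\mathcal{A}$ with domain $U$ is interpretable in $M$ by systems of equations (e-interpretable) if there are $n\in\mathbb{N}$, an e-definable set $S\subseteq M^n$ and a bijection $\phi:S\to U$ such that the preimage under $\phi$ of the graph of every function and of every relation (including equality) in the language of $\mathcal{A}$ is e-definable in $M$. *)

theory Defs
  imports
    "HOL-Algebra.Group"
    "HOL-Library.Sublist"
    "HOL-Library.Nat_Bijection"
    "HOL-Library.Countable_Set"
begin

section \<open>Monoid presentations\<close>

inductive_set pres_cong :: "'a set \<Rightarrow> ('a list \<times> 'a list) set \<Rightarrow> ('a list \<times> 'a list) set"
  for A :: "'a set" and R :: "('a list \<times> 'a list) set" where
  base: "(u, v) \<in> R \<Longrightarrow> u \<in> lists A \<Longrightarrow> v \<in> lists A \<Longrightarrow> (u, v) \<in> pres_cong A R"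
| refl: "u \<in> lists A \<Longrightarrow> (u, u) \<in> pres_cong A R"
| sym: "(u, v) \<in> pres_cong A R \<Longrightarrow> (v, u) \<in> pres_cong A R"
| trans: "(u, v) \<in> pres_cong A R \<Longrightarrow> (v, w) \<in> pres_cong A R \<Longrightarrow> (u, w) \<in> pres_cong A R"
| ctxt: "(u, v) \<in> pres_cong A R \<Longrightarrow> p \<in> lists A \<Longrightarrow> q \<in> lists A \<Longrightarrow>
    (p @ u @ q, p @ v @ q) \<in> pres_cong A R"

text \<open>The class of a word, i.e. the element of the presented monoid that the word represents.\<close>

definition pres_class :: "'a set \<Rightarrow> ('a list \<times> 'a list) set \<Rightarrow> 'a list \<Rightarrow> 'a list set" where
  "pres_class A R w = pres_cong A R `` {w}"

text \<open>Structures in the language of monoids, extended by finitely many binary relation symbols,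
  which are numbered by their position in the list.\<close>

record 'u rel_monoid = "'u monoid" +
  rels :: "('u \<times> 'u) set list"

definition presented_monoid :: "'a set \<Rightarrow> ('a list \<times> 'a list) set \<Rightarrow> 'a list set rel_monoid" where
  "presented_monoid A R =
    \<lparr>carrier = lists A // pres_cong A R,
     monoid.mult = (\<lambda>X Y. \<Union>u\<in>X. \<Union>v\<in>Y. pres_class A R (u @ v)),
     one = pres_class A R [],
     rels = []\<rparr>"

definition one_relator_monoid :: "'a set \<Rightarrow> 'a list \<Rightarrow> 'a list set rel_monoid" where
  "one_relator_monoid A r = presented_monoid A {(r, [])}"

definition represents_unit :: "'a set \<Rightarrow> 'a list \<Rightarrow> 'a list \<Rightarrow> bool" where
  "represents_unit A r w \<longleftrightarrow> pres_class A {(r, [])} w \<in> Units (one_relator_monoid A r)"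

definition minimal_invertible_decomposition :: "'a set \<Rightarrow> 'a list \<Rightarrow> 'a list list \<Rightarrow> bool" where
  "minimal_invertible_decomposition A r rs \<longleftrightarrow>
    concat rs = r \<and>
    (\<forall>p\<in>set rs. p \<in> lists A \<and> p \<noteq> [] \<and> represents_unit A r p \<and>
      (\<forall>q. strict_prefix q p \<and> q \<noteq> [] \<longrightarrow> \<not> represents_unit A r q))"

section \<open>Free monoids with a length relation\<close>

definition free_monoid_with_length :: "nat \<Rightarrow> (nat list \<Rightarrow> nat) \<Rightarrow> nat list rel_monoid" where
  "free_monoid_with_length n len =
    \<lparr>carrier = lists {..<n},
     monoid.mult = (@),
     one = [],
     rels = [{(u, v). u \<in> lists {..<n} \<and> v \<in> lists {..<n} \<and> len u \<le> len v}]\<rparr>"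

definition weighted_length :: "nat \<Rightarrow> (nat \<Rightarrow> nat) \<Rightarrow> nat list \<Rightarrow> nat" where
  "weighted_length n lam w = (\<Sum>i<n. lam i * count_list w i)"

section \<open>Systems of equations\<close>

text \<open>Terms are words in variables and coefficients. The type \<open>'c\<close> of coefficients is separate from
  the type of elements: coefficients are either elements themselves or words naming elements.\<close>

datatype 'c symb = Var nat | Coef 'c

datatype 'c equation =
    Eq "'c symb list" "'c symb list"
  | Rel nat "'c symb list" "'c symb list"

type_synonym 'c system = "'c equation list"

fun symb_val :: "('c \<Rightarrow> 'u) \<Rightarrow> (nat \<Rightarrow> 'u) \<Rightarrow> 'c symb \<Rightarrow> 'u" where
  "symb_val \<iota> \<sigma> (Var i) = \<sigma> i"
| "symb_val \<iota> \<sigma> (Coef c) = \<iota> c"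

definition word_val :: "('u, 'm) monoid_scheme \<Rightarrow> ('c \<Rightarrow> 'u) \<Rightarrow> (nat \<Rightarrow> 'u) \<Rightarrow> 'c symb list \<Rightarrow> 'u" where
  "word_val M \<iota> \<sigma> w = foldr (\<lambda>s x. symb_val \<iota> \<sigma> s \<otimes>\<^bsub>M\<^esub> x) w \<one>\<^bsub>M\<^esub>"

fun equation_holds :: "'u rel_monoid \<Rightarrow> ('c \<Rightarrow> 'u) \<Rightarrow> (nat \<Rightarrow> 'u) \<Rightarrow> 'c equation \<Rightarrow> bool" where
  "equation_holds M \<iota> \<sigma> (Eq u v) \<longleftrightarrow> word_val M \<iota> \<sigma> u = word_val M \<iota> \<sigma> v"
| "equation_holds M \<iota> \<sigma> (Rel i u v) \<longleftrightarrow> (word_val M \<iota> \<sigma> u, word_val M \<iota> \<sigma> v) \<in> rels M ! i"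

fun equation_over :: "'u rel_monoid \<Rightarrow> 'c set \<Rightarrow> 'c equation \<Rightarrow> bool" where
  "equation_over M C (Eq u v) \<longleftrightarrow> (\<Union>s\<in>set (u @ v). set_symb s) \<subseteq> C"
| "equation_over M C (Rel i u v) \<longleftrightarrow> i < length (rels M) \<and> (\<Union>s\<in>set (u @ v). set_symb s) \<subseteq> C"

definition system_over :: "'u rel_monoid \<Rightarrow> 'c set \<Rightarrow> 'c system \<Rightarrow> bool" where
  "system_over M C \<Sigma> \<longleftrightarrow> (\<forall>e\<in>set \<Sigma>. equation_over M C e)"

definition solves :: "'u rel_monoid \<Rightarrow> ('c \<Rightarrow> 'u) \<Rightarrow> (nat \<Rightarrow> 'u) \<Rightarrow> 'c system \<Rightarrow> bool" where
  "solves M \<iota> \<sigma> \<Sigma> \<longleftrightarrow> range \<sigma> \<subseteq> carrier M \<and> (\<forall>e\<in>set \<Sigma>. equation_holds M \<iota> \<sigma> e)"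

section \<open>Definability and interpretability by systems of equations\<close>

definition tuples :: "nat \<Rightarrow> 'u set \<Rightarrow> 'u list set" where
  "tuples n U = {m. length m = n \<and> set m \<subseteq> U}"

text \<open>The variables with index below \<open>n\<close> play the role of the free variables, all others are
  existentially quantified; only finitely many of them occur in \<open>\<Sigma>\<close>.\<close>

definition e_definable :: "'u rel_monoid \<Rightarrow> nat \<Rightarrow> 'u list set \<Rightarrow> bool" where
  "e_definable M n S \<longleftrightarrow> S \<subseteq> tuples n (carrier M) \<and>
    (\<exists>\<Sigma> :: 'u system. system_over M (carrier M) \<Sigma> \<and>
      (\<forall>m\<in>tuples n (carrier M).
        m \<in> S \<longleftrightarrow> (\<exists>\<sigma>. (\<forall>i<n. \<sigma> i = m ! i) \<and> solves M (\<lambda>c. c) \<sigma> \<Sigma>)))"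

text \<open>Interpretability of \<open>D\<close> in \<open>M\<close>; a tuple of tuples is identified with its concatenation.\<close>

definition e_interpretable :: "'v rel_monoid \<Rightarrow> 'u rel_monoid \<Rightarrow> bool" where
  "e_interpretable D M \<longleftrightarrow> (\<exists>n S (\<phi> :: 'u list \<Rightarrow> 'v).
    e_definable M n S \<and>
    bij_betw \<phi> S (carrier D) \<and>
    e_definable M (2 * n) {x @ y | x y. x \<in> S \<and> y \<in> S \<and> \<phi> x = \<phi> y} \<and>
    e_definable M n {x \<in> S. \<phi> x = \<one>\<^bsub>D\<^esub>} \<and>
    e_definable M (3 * n)
      {x @ y @ z | x y z. x \<in> S \<and> y \<in> S \<and> z \<in> S \<and> \<phi> x \<otimes>\<^bsub>D\<^esub> \<phi> y = \<phi> z} \<and>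
    (\<forall>R\<in>set (rels D). e_definable M (2 * n) {x @ y | x y. x \<in> S \<and> y \<in> S \<and> (\<phi> x, \<phi> y) \<in> R}))"

section \<open>Turing reducibility\<close>

text \<open>Syntax and semantics of partial recursive functions relative to an oracle set.\<close>

datatype recf = Zero | Succ | Proj nat | Oracle | Comp recf "recf list" | PrimRec recf recf | Mu recf

inductive rec_eval :: "nat set \<Rightarrow> recf \<Rightarrow> nat list \<Rightarrow> nat \<Rightarrow> bool" for Q :: "nat set" where
  "rec_eval Q Zero xs 0"
| "rec_eval Q Succ [x] (Suc x)"
| "i < length xs \<Longrightarrow> rec_eval Q (Proj i) xs (xs ! i)"
| "rec_eval Q Oracle [x] (of_bool (x \<in> Q))"
| "list_all2 (\<lambda>g y. rec_eval Q g xs y) gs ys \<Longrightarrow> rec_eval Q f ys z \<Longrightarrow> rec_eval Q (Comp f gs) xs z"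
| "rec_eval Q f xs y \<Longrightarrow> rec_eval Q (PrimRec f g) (0 # xs) y"
| "rec_eval Q (PrimRec f g) (k # xs) y \<Longrightarrow> rec_eval Q g (k # y # xs) z \<Longrightarrow>
    rec_eval Q (PrimRec f g) (Suc k # xs) z"
| "rec_eval Q f (y # xs) 0 \<Longrightarrow> \<forall>z<y. \<exists>v. rec_eval Q f (z # xs) (Suc v) \<Longrightarrow> rec_eval Q (Mu f) xs y"

text \<open>The evaluation relation is single-valued, so that every program computes a partial function.\<close>

inductive_cases rec_eval_casesE:
  "rec_eval Q Zero xs z" "rec_eval Q Succ xs z" "rec_eval Q (Proj i) xs z" "rec_eval Q Oracle xs z"
  "rec_eval Q (Comp f gs) xs z" "rec_eval Q (PrimRec f g) (0 # xs) z"
  "rec_eval Q (PrimRec f g) (Suc k # xs) z" "rec_eval Q (Mu f) xs z"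

lemma rec_eval_deterministic: "rec_eval Q f xs y \<Longrightarrow> rec_eval Q f xs z \<Longrightarrow> y = z"
proof (induction arbitrary: z rule: rec_eval.induct)
  case (5 xs gs ys f w)
  from 5(4) obtain ys' where *: "list_all2 (\<lambda>g y. rec_eval Q g xs y) gs ys'" "rec_eval Q f ys' z"
    by (rule rec_eval_casesE)
  have "ys ! i = ys' ! i" if "i < length gs" for i
    using that 5(1) *(1) unfolding list_all2_conv_all_nth by blast
  moreover have "length ys = length gs" "length ys' = length gs"
    using 5(1) *(1) unfolding list_all2_conv_all_nth by simp_all
  ultimately have "ys = ys'"
    by (intro nth_equalityI) simp_all
  with *(2) have "rec_eval Q f ys z" by simp
  then show ?case by (rule 5(2))
next
  case (7 f g k xs y w)
  from 7(5) obtain y' where *: "rec_eval Q (PrimRec f g) (k # xs) y'" "rec_eval Q g (k # y' # xs) z"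
    by (rule rec_eval_casesE)
  have "y = y'" using 7(3)[OF *(1)] .
  with *(2) have "rec_eval Q g (k # y # xs) z" by simp
  then show ?case by (rule 7(4))
next
  case (8 f y xs)
  from 8(4) obtain *: "rec_eval Q f (z # xs) 0" "\<forall>x<z. \<exists>v. rec_eval Q f (x # xs) (Suc v)"
    by (rule rec_eval_casesE)
  show ?case
  proof (rule linorder_cases[of y z])
    assume "y < z"
    then obtain v where "rec_eval Q f (y # xs) (Suc v)" using *(2) by blast
    from 8(2)[OF this] show ?thesis by simp
  next
    assume "z < y"
    then obtain v where "\<forall>w. rec_eval Q f (z # xs) w \<longrightarrow> Suc v = w" using 8(3) by blast
    with *(1) show ?thesis by blast
  qed simp
next
  case (6 f xs y g)
  from 6(3) have "rec_eval Q f xs z" by (rule rec_eval_casesE)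
  then show ?case by (rule 6(2))
qed (erule rec_eval_casesE, simp)+

definition turing_reducible :: "nat set \<Rightarrow> nat set \<Rightarrow> bool" where
  "turing_reducible P Q \<longleftrightarrow> (\<exists>f. \<forall>x. rec_eval Q f [x] (of_bool (x \<in> P)))"

section \<open>The Diophantine problem\<close>

fun symb_code :: "('a \<Rightarrow> nat) \<Rightarrow> 'a list symb \<Rightarrow> nat" where
  "symb_code num (Var i) = sum_encode (Inl i)"
| "symb_code num (Coef w) = sum_encode (Inr (list_encode (map num w)))"

definition word_code :: "('a \<Rightarrow> nat) \<Rightarrow> 'a list symb list \<Rightarrow> nat" where
  "word_code num w = list_encode (map (symb_code num) w)"

fun equation_code :: "('a \<Rightarrow> nat) \<Rightarrow> 'a list equation \<Rightarrow> nat" where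
  "equation_code num (Eq u v) = sum_encode (Inl (prod_encode (word_code num u, word_code num v)))"
| "equation_code num (Rel i u v) =
    sum_encode (Inr (prod_encode (i, prod_encode (word_code num u, word_code num v))))"

definition system_code :: "('a \<Rightarrow> nat) \<Rightarrow> 'a list system \<Rightarrow> nat" where
  "system_code num \<Sigma> = list_encode (map (equation_code num) \<Sigma>)"

text \<open>The set of codes of the solvable systems over \<open>M\<close> whose coefficients are words over the
  finite generating set \<open>A\<close>, the word \<open>w\<close> denoting the element \<open>\<iota> w\<close>. For finite \<open>A\<close> the
  numbering \<^term>\<open>to_nat_on A\<close> is a bijection onto the numbers below \<^term>\<open>card A\<close>; which
  bijection it is does not affect the Turing degree.\<close>

definition diophantine_problem :: "'u rel_monoid \<Rightarrow> 'a set \<Rightarrow> ('a list \<Rightarrow> 'u) \<Rightarrow> nat set" where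
  "diophantine_problem M A \<iota> =
    {system_code (to_nat_on A) \<Sigma> | \<Sigma>. system_over M (lists A) \<Sigma> \<and> (\<exists>\<sigma>. solves M \<iota> \<sigma> \<Sigma>)}"

definition diophantine_one_relator :: "'a set \<Rightarrow> 'a list \<Rightarrow> nat set" where
  "diophantine_one_relator A r =
    diophantine_problem (one_relator_monoid A r) A (pres_class A {(r, [])})"

definition diophantine_free_with_length :: "nat \<Rightarrow> (nat list \<Rightarrow> nat) \<Rightarrow> nat set" where
  "diophantine_free_with_length n len =
    diophantine_problem (free_monoid_with_length n len) {..<n} (\<lambda>w. w)"

end

theory Submission
  imports Defs
begin

text \<open>
  Write \<open>M\<close> for the one-relator monoid and \<open>\<Delta>\<close> for the set of minimal invertible pieces of its relator.
  Two distinct pieces do not overlap: the common part would have a left and a right inverse, hence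
  would be a unit, against minimality. Together with condition (C1), which excludes nesting, this
  says that occurrences of pieces in a word are pairwise disjoint (\<open>occurrence_unique\<close>).

  This makes normal forms easy. A stack is a list of letters and units, topmost entry first. A letter is
  pushed onto the stack, and as soon as a piece lies on top it is replaced by the unit that it
  represents and multiplied into the unit below, if there is one. As pieces are disjoint, pushing
  the letters of a piece one by one has just the effect of multiplying by its unit; so pushing the
  relator changes nothing, \<open>M\<close> acts on stacks (\<open>act_cong\<close>), and the stack obtained from the empty one
  is a normal form of the elements of \<open>M\<close>.

  Let \<open>\<alpha>\<close> be the class of the letter \<open>a\<close>. No piece ends in \<open>a\<close>, since two pieces start with it, and
  comparing normal forms of \<open>x \<otimes> \<alpha>\<close> and \<open>\<alpha> \<otimes> x\<close> shows that only the powers of \<open>\<alpha>\<close> commute with \<open>\<alpha>\<close>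
  (\<open>centralizer_of_a\<close>). If a piece is \<open>\<epsilon> = a\<^sup>j s\<close> with \<open>j \<ge> 1\<close>, then \<open>s \<epsilon>\<inverse>\<close> is a right inverse of \<open>\<alpha>\<^sup>j\<close>. If \<open>y\<close> is
  any right inverse of \<open>\<alpha>\<^sup>k\<close> with \<open>k \<ge> 1\<close>, push the letter \<open>a\<close> repeatedly onto the normal form of \<open>y\<close>: the
  first reduction exhibits such an element as a left factor of \<open>y\<close>, the factor is determined by \<open>y\<close>,
  and induction applies to the rest. Hence the right inverses of powers of \<open>\<alpha>\<close> form a free monoid \<open>D\<close>
  on the finitely many elements \<open>s \<epsilon>\<inverse>\<close> (\<open>pow_a_right_inverse_iff\<close>, \<open>generators_free\<close>), and the exponent \<open>k\<close>
  is the length of \<open>y\<close> if the generator \<open>s \<epsilon>\<inverse>\<close> gets the weight \<open>j\<close>. The words \<open>\<gamma>\<close> and \<open>\<delta>\<close> give two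
  generators; under (C3) every weight is 1.

  So equations can speak about \<open>D\<close> and its length: \<open>y \<in> D\<close> iff some \<open>x\<close> commuting with \<open>\<alpha>\<close> satisfies
  \<open>x \<otimes> y = \<one>\<close>, and \<open>u\<close> is not longer than \<open>v\<close> iff there are \<open>x\<close> and \<open>z\<close> that commute with \<open>\<alpha>\<close> such that
  \<open>x \<otimes> u = \<one>\<close> and \<open>z \<otimes> x \<otimes> v = \<one>\<close>; for then \<open>x = \<alpha>\<^bsup>|u|\<^esup>\<close> and \<open>z \<otimes> x = \<alpha>\<^bsup>|v|\<^esup>\<close>. This is an interpretation
  of dimension one (\<open>e_interpretable_in_M\<close>). It also turns a system over \<open>D\<close> into an equivalent system
  over \<open>M\<close> by adding equations and fresh variables for the witnesses \<open>x\<close> and \<open>z\<close>. On codes this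
  translation is primitive recursive, so one query to the oracle for \<open>M\<close> decides solvability over \<open>D\<close>
  (\<open>diophantine_problem_reducible\<close>).
\<close>

section \<open>Monoid presentations\<close>

text \<open>
  Words over an alphabet are handled through the structure of lists (\<open>append\<close>, \<open>Cons\<close>) throughout;
  the default rules would unfold membership in \<^term>\<open>lists A\<close> to a statement about single letters.
\<close>

declare in_listsD [rule del] in_listsI [rule del]

lemma pres_cong_lists:
  assumes "(u, v) \<in> pres_cong A R"
  shows "u \<in> lists A \<and> v \<in> lists A"
  using assms by induction auto

lemma pres_class_eq_iff:
  assumes "u \<in> lists A"
  shows "pres_class A R u = pres_class A R v \<longleftrightarrow> (u, v) \<in> pres_cong A R"
proof
  assume "pres_class A R u = pres_class A R v"
  then have "u \<in> pres_class A R v"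
    using pres_cong.refl[OF assms] by (auto simp only: pres_class_def)
  then show "(u, v) \<in> pres_cong A R"
    unfolding pres_class_def Image_singleton_iff by (rule pres_cong.sym)
next
  assume *: "(u, v) \<in> pres_cong A R"
  show "pres_class A R u = pres_class A R v"
    unfolding pres_class_def set_eq_iff Image_singleton_iff
    using pres_cong.trans[OF *] pres_cong.trans[OF pres_cong.sym[OF *]] by blast
qed

lemma pres_class_self: "u \<in> lists A \<Longrightarrow> u \<in> pres_class A R u"
  unfolding pres_class_def Image_singleton_iff by (rule pres_cong.refl)

lemma pres_cong_append:
  assumes "(u, u') \<in> pres_cong A R" and "(v, v') \<in> pres_cong A R"
  shows "(u @ v, u' @ v') \<in> pres_cong A R"
proof -
  have "([] @ u @ v, [] @ u' @ v) \<in> pres_cong A R"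
    using assms pres_cong_lists by (metis lists.Nil pres_cong.ctxt)
  moreover have "(u' @ v @ [], u' @ v' @ []) \<in> pres_cong A R"
    using assms pres_cong_lists by (metis lists.Nil pres_cong.ctxt)
  ultimately show ?thesis
    using pres_cong.trans by (metis append_Nil append_Nil2)
qed

lemma carrier_presented_monoid: "carrier (presented_monoid A R) = pres_class A R ` lists A"
  by (auto simp: presented_monoid_def quotient_def pres_class_def)

lemma one_presented_monoid: "\<one>\<^bsub>presented_monoid A R\<^esub> = pres_class A R []"
  by (simp add: presented_monoid_def)

lemma mult_presented_monoid:
  assumes "u \<in> lists A" and "v \<in> lists A"
  shows "pres_class A R u \<otimes>\<^bsub>presented_monoid A R\<^esub> pres_class A R v = pres_class A R (u @ v)"
proof -
  have "pres_class A R (u' @ v') = pres_class A R (u @ v)"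
    if "u' \<in> pres_class A R u" "v' \<in> pres_class A R v" for u' v'
  proof -
    have *: "(u, u') \<in> pres_cong A R" "(v, v') \<in> pres_cong A R"
      using that by (auto simp: pres_class_def)
    then show ?thesis
      using pres_class_eq_iff[of "u @ v" A R "u' @ v'"] pres_cong_append[OF *] assms by simp
  qed
  moreover have "u \<in> pres_class A R u" "v \<in> pres_class A R v"
    using assms pres_class_self by blast+
  ultimately have "(\<Union>u'\<in>pres_class A R u. \<Union>v'\<in>pres_class A R v. pres_class A R (u' @ v'))
      = pres_class A R (u @ v)"
    by blast
  then show ?thesis
    unfolding presented_monoid_def by simp
qed

lemma monoid_presented_monoid: "monoid (presented_monoid A R)"
proof (rule monoidI, unfold carrier_presented_monoid one_presented_monoid)
  fix x y z
  assume "x \<in> pres_class A R ` lists A" "y \<in> pres_class A R ` lists A" "z \<in> pres_class A R ` lists A"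
  then obtain u v w where *: "u \<in> lists A" "v \<in> lists A" "w \<in> lists A"
    and [simp]: "x = pres_class A R u" "y = pres_class A R v" "z = pres_class A R w"
    by blast
  show "x \<otimes>\<^bsub>presented_monoid A R\<^esub> y \<in> pres_class A R ` lists A"
    "x \<otimes>\<^bsub>presented_monoid A R\<^esub> y \<otimes>\<^bsub>presented_monoid A R\<^esub> z
      = x \<otimes>\<^bsub>presented_monoid A R\<^esub> (y \<otimes>\<^bsub>presented_monoid A R\<^esub> z)"
    using * by (simp_all add: mult_presented_monoid)
next
  fix x
  assume "x \<in> pres_class A R ` lists A"
  then obtain u where *: "u \<in> lists A" and [simp]: "x = pres_class A R u"
    by blast
  show "pres_class A R [] \<otimes>\<^bsub>presented_monoid A R\<^esub> x = x"
    "x \<otimes>\<^bsub>presented_monoid A R\<^esub> pres_class A R [] = x"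
    using * by (simp_all add: mult_presented_monoid)
qed simp

text \<open>
  The right inverse that comes from \<open>x \<otimes> y\<close> and the left inverse that comes from \<open>z \<otimes> x\<close> agree.
\<close>

lemma (in monoid) Units_if_two_sided:
  assumes "x \<in> carrier G" "y \<in> carrier G" "z \<in> carrier G"
    and "x \<otimes> y \<in> Units G" and "z \<otimes> x \<in> Units G"
  shows "x \<in> Units G"
proof -
  let ?R = "y \<otimes> inv (x \<otimes> y)" and ?L = "inv (z \<otimes> x) \<otimes> z"
  have R: "x \<otimes> ?R = \<one>" "?R \<in> carrier G" and L: "?L \<otimes> x = \<one>" "?L \<in> carrier G"
    using assms by (auto simp: m_assoc[symmetric]) (simp add: m_assoc)
  have "?L = ?R"
    using inv_unique[OF L(1) R(1)] assms(1) L(2) R(2) by simp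
  then show ?thesis
    using R L assms(1) unfolding Units_def by auto
qed

section \<open>Minimal invertible pieces and normal forms\<close>

locale minimal_pieces =
  fixes A :: "'a set" and r :: "'a list" and rs :: "'a list list" and \<Delta> :: "'a list set"
  assumes decomposition: "minimal_invertible_decomposition A r rs"
    and pieces: "\<Delta> = set rs"
    and no_strict_sublist: "\<And>u v. u \<in> \<Delta> \<Longrightarrow> v \<in> \<Delta> \<Longrightarrow> \<not> strict_sublist u v"
begin

abbreviation M :: "'a list set rel_monoid" where
  "M \<equiv> one_relator_monoid A r"

abbreviation cls :: "'a list \<Rightarrow> 'a list set" where
  "cls \<equiv> pres_class A {(r, [])}"

sublocale M: monoid M
  unfolding one_relator_monoid_def by (rule monoid_presented_monoid)

lemma carrier_M: "carrier M = cls ` lists A"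
  and one_M: "\<one>\<^bsub>M\<^esub> = cls []"
  and mult_M: "u \<in> lists A \<Longrightarrow> v \<in> lists A \<Longrightarrow> cls u \<otimes>\<^bsub>M\<^esub> cls v = cls (u @ v)"
  unfolding one_relator_monoid_def
  by (simp_all add: carrier_presented_monoid one_presented_monoid mult_presented_monoid)

lemma cls_closed [intro]: "u \<in> lists A \<Longrightarrow> cls u \<in> carrier M"
  by (simp add: carrier_M)

lemma cls_pow: "u \<in> lists A \<Longrightarrow> cls u [^]\<^bsub>M\<^esub> n = cls (concat (replicate n u))"
proof (induction n)
  case (Suc n)
  have "concat (replicate n u) @ u = u @ concat (replicate n u)"
    by (induction n) auto
  moreover have "concat (replicate n u) \<in> lists A"
    using Suc.prems by (induction n) auto
  ultimately show ?case
    using Suc by (simp add: mult_M)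
qed (simp add: one_M)

lemma piece_lists: "\<delta> \<in> \<Delta> \<Longrightarrow> \<delta> \<in> lists A"
  and piece_nonempty: "\<delta> \<in> \<Delta> \<Longrightarrow> \<delta> \<noteq> []"
  and piece_unit: "\<delta> \<in> \<Delta> \<Longrightarrow> cls \<delta> \<in> Units M"
  and piece_minimal: "\<delta> \<in> \<Delta> \<Longrightarrow> strict_prefix q \<delta> \<Longrightarrow> q \<noteq> [] \<Longrightarrow> cls q \<notin> Units M"
  and concat_rs: "concat rs = r"
  using decomposition
  by (auto simp: minimal_invertible_decomposition_def pieces represents_unit_def)

lemma concat_pieces_lists: "set ds \<subseteq> \<Delta> \<Longrightarrow> concat ds \<in> lists A"
  by (induction ds) (auto simp: piece_lists)

lemma r_lists: "r \<in> lists A"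
  using concat_pieces_lists[of rs] concat_rs pieces by simp

lemma cls_r: "cls r = \<one>\<^bsub>M\<^esub>"
  using pres_class_eq_iff[OF r_lists, of "{(r, [])}" "[]"] r_lists
  by (simp add: one_M pres_cong.base)

text \<open>
  The overlap \<open>s\<close> is a suffix of one unit and a prefix of another, so it is a unit itself and by
  minimality cannot be a proper prefix of the second piece.
\<close>

lemma pieces_do_not_overlap:
  assumes "p @ s \<in> \<Delta>" "s @ t \<in> \<Delta>" "s \<noteq> []"
  shows "t = []"
proof (rule ccontr)
  assume "t \<noteq> []"
  have l: "p \<in> lists A" "s \<in> lists A" "t \<in> lists A"
    using assms(1,2)[THEN piece_lists] by auto
  have "cls s \<in> Units M"
    using l piece_unit[OF assms(1)] piece_unit[OF assms(2)]
    by (intro M.Units_if_two_sided[of "cls s" "cls t" "cls p"]) (auto simp: mult_M)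
  then show False
    using piece_minimal[OF assms(2), of s] assms(3) \<open>t \<noteq> []\<close> by (auto simp: strict_prefix_def)
qed

type_synonym (in -) 'b stack = "('b + 'b list set) list"

text \<open>
  The combinatorial core: a piece \<open>\<delta>\<close> that starts inside an occurrence of the piece \<open>\<eta>\<close> either ends
  inside it, which is excluded by \<open>no_strict_sublist\<close>, or overlaps with it. All uniqueness and
  confluence arguments below rest on this lemma.
\<close>

lemma occurrence_unique:
  fixes x y p :: "'a stack"
  assumes "p @ map Inl \<delta> @ x = map Inl \<eta> @ y" "\<delta> \<in> \<Delta>" "\<eta> \<in> \<Delta>" "length p < length \<eta>"
  shows "p = [] \<and> \<delta> = \<eta> \<and> x = y"
proof -
  obtain t where t: "map Inl \<eta> = p @ t" "map Inl \<delta> @ x = t @ y"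
  proof -
    from assms(1) obtain us where "p @ us = map Inl \<eta> \<and> map Inl \<delta> @ x = us @ y
      \<or> p = map Inl \<eta> @ us \<and> us @ map Inl \<delta> @ x = y"
      unfolding append_eq_append_conv2 by blast
    then show ?thesis
    proof
      assume "p = map Inl \<eta> @ us \<and> us @ map Inl \<delta> @ x = y"
      then have "length p = length \<eta> + length us"
        by simp
      then show ?thesis
        using assms(4) by simp
    qed (use that[of us] in simp)
  qed
  then obtain p' t' where p': "p = map Inl p'" "t = map Inl t'" "\<eta> = p' @ t'"
    by (auto simp: map_eq_append_conv)
  have "t' \<noteq> []"
    using assms(4) p' by auto
  from t(2) consider (inside) s where "map Inl \<delta> @ s = t" | (overlap) s where "map Inl \<delta> = t @ s"
    by (auto simp: append_eq_append_conv2)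
  then show ?thesis
  proof cases
    case inside
    then obtain s' where "t' = \<delta> @ s'"
      using p' by (auto simp: append_eq_map_conv inj_map_eq_map)
    then have "\<eta> = p' @ \<delta> @ s'"
      using p' by simp
    then have "sublist \<delta> \<eta>"
      by (auto simp: sublist_def)
    then have "\<delta> = \<eta>"
      using no_strict_sublist[OF assms(2,3)] by (auto simp: strict_sublist_def)
    moreover have "length \<eta> = length p' + length \<delta> + length s'"
      using \<open>\<eta> = p' @ \<delta> @ s'\<close> by simp
    ultimately have "p' = []" "s' = []"
      by auto
    then show ?thesis
      using assms(1) p' \<open>\<delta> = \<eta>\<close> by simp
  next
    case overlap
    then obtain s' where s': "\<delta> = t' @ s'"
      using p' by (auto simp: map_eq_append_conv inj_map_eq_map)
    then have "s' = []"
      using pieces_do_not_overlap[of p' t' s'] assms p' \<open>t' \<noteq> []\<close> by simp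
    then have "sublist \<delta> \<eta>"
      using s' p' by (metis append_Nil2 sublist_appendI)
    then have "\<delta> = \<eta>"
      using no_strict_sublist[OF assms(2,3)] by (auto simp: strict_sublist_def)
    then show ?thesis
      using assms(1) p' s' \<open>s' = []\<close> by simp
  qed
qed

text \<open>
  Adjacent units are merged and the identity is never stored,
  so that a stack without adjacent units and identities stays so.
\<close>

fun smul :: "'a list set \<Rightarrow> 'a stack \<Rightarrow> 'a stack" where
  "smul g (Inr h # x) = (if g \<otimes>\<^bsub>M\<^esub> h = \<one>\<^bsub>M\<^esub> then x else Inr (g \<otimes>\<^bsub>M\<^esub> h) # x)"
| "smul g x = (if g = \<one>\<^bsub>M\<^esub> then x else Inr g # x)"

text \<open>
  The definite description is justified by \<open>occurrence_unique\<close> with empty \<open>p\<close>: at most one piece is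
  on top of the stack.
\<close>

definition push :: "'a \<Rightarrow> 'a stack \<Rightarrow> 'a stack" where
  "push c x = (if \<exists>\<delta>\<in>\<Delta>. \<exists>z. Inl c # x = map Inl \<delta> @ z
     then (THE y. \<exists>\<delta>\<in>\<Delta>. \<exists>z. Inl c # x = map Inl \<delta> @ z \<and> y = smul (cls \<delta>) z)
     else Inl c # x)"

definition act :: "'a list \<Rightarrow> 'a stack \<Rightarrow> 'a stack" where
  "act w x = foldr push w x"

lemma act_simps [simp]: "act [] x = x" "act (c # w) x = push c (act w x)"
  "act (u @ v) x = act u (act v x)"
  by (simp_all add: act_def)

lemma push_reduce:
  assumes "\<delta> \<in> \<Delta>" "Inl c # x = map Inl \<delta> @ z"
  shows "push c x = smul (cls \<delta>) z"
proof -
  have "y = smul (cls \<delta>) z"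
    if "\<eta> \<in> \<Delta>" "Inl c # x = map Inl \<eta> @ z'" "y = smul (cls \<eta>) z'" for y \<eta> z'
    using occurrence_unique[of "[]" \<eta> z' \<delta> z] that assms piece_nonempty[of \<delta>] by auto
  then have "(THE y. \<exists>\<delta>\<in>\<Delta>. \<exists>z. Inl c # x = map Inl \<delta> @ z \<and> y = smul (cls \<delta>) z) = smul (cls \<delta>) z"
    using assms by (intro the_equality) blast+
  then show ?thesis
    using assms unfolding push_def by auto
qed

lemma push_stay:
  assumes "\<And>\<delta> z. \<delta> \<in> \<Delta> \<Longrightarrow> Inl c # x \<noteq> map Inl \<delta> @ z"
  shows "push c x = Inl c # x"
  using assms unfolding push_def by auto

lemma push_cases:
  obtains (reduce) \<delta> z where "\<delta> \<in> \<Delta>" "Inl c # x = map Inl \<delta> @ z" "push c x = smul (cls \<delta>) z"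
  | (stay) "\<And>\<delta> z. \<delta> \<in> \<Delta> \<Longrightarrow> Inl c # x \<noteq> map Inl \<delta> @ z" "push c x = Inl c # x"
  using push_reduce push_stay by metis

text \<open>
  The invariant of stacks under which \<open>smul\<close> is an action of the group of units.
\<close>

definition wf_stack :: "'a stack \<Rightarrow> bool" where
  "wf_stack x \<longleftrightarrow> successively (\<lambda>e f. isl e \<or> isl f) x \<and>
     (\<forall>e\<in>set x. case e of Inl c \<Rightarrow> c \<in> A | Inr g \<Rightarrow> g \<in> Units M \<and> g \<noteq> \<one>\<^bsub>M\<^esub>)"

lemma wf_stack_Nil [simp]: "wf_stack []"
  and wf_stack_Inl [simp]: "wf_stack (Inl c # x) \<longleftrightarrow> c \<in> A \<and> wf_stack x"
  and wf_stack_Inr: "wf_stack (Inr g # x) \<longleftrightarrow>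
    g \<in> Units M \<and> g \<noteq> \<one>\<^bsub>M\<^esub> \<and> (x = [] \<or> isl (hd x)) \<and> wf_stack x"
  by (auto simp: wf_stack_def successively_Cons)

lemma wf_stack_append: "wf_stack (x @ y) \<Longrightarrow> wf_stack y"
  by (auto simp: wf_stack_def successively_append_iff)

lemma smul_head: "x = [] \<or> isl (hd x) \<Longrightarrow> smul g x = (if g = \<one>\<^bsub>M\<^esub> then x else Inr g # x)"
  by (cases "(g, x)" rule: smul.cases) auto

lemma wf_smul:
  assumes "wf_stack x" "g \<in> Units M"
  shows "wf_stack (smul g x)"
  using assms by (cases "(g, x)" rule: smul.cases) (auto simp: wf_stack_Inr)

lemma smul_one:
  assumes "wf_stack x"
  shows "smul \<one>\<^bsub>M\<^esub> x = x"
  using assms by (cases "(\<one>\<^bsub>M\<^esub>, x)" rule: smul.cases) (auto simp: wf_stack_Inr M.Units_closed)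

lemma smul_smul:
  assumes "wf_stack x" "g \<in> Units M" "h \<in> Units M"
  shows "smul g (smul h x) = smul (g \<otimes>\<^bsub>M\<^esub> h) x"
proof (cases "x = [] \<or> isl (hd x)")
  case True
  then show ?thesis
    using assms by (auto simp: smul_head M.Units_closed)
next
  case False
  then obtain k y where x: "x = Inr k # y"
    by (cases x; cases "hd x") auto
  with assms have k: "k \<in> Units M" "k \<noteq> \<one>\<^bsub>M\<^esub>" "y = [] \<or> isl (hd y)"
    by (auto simp: wf_stack_Inr)
  have [simp]: "g \<otimes>\<^bsub>M\<^esub> h \<otimes>\<^bsub>M\<^esub> k = g \<otimes>\<^bsub>M\<^esub> (h \<otimes>\<^bsub>M\<^esub> k)"
    using assms k by (simp add: M.m_assoc M.Units_closed)
  show ?thesis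
    using assms k x by (auto simp: smul_head M.Units_closed)
qed

lemma wf_push:
  assumes "wf_stack x" "c \<in> A"
  shows "wf_stack (push c x)"
proof (cases c x rule: push_cases)
  case (reduce \<delta> z)
  have "wf_stack (map Inl \<delta> @ z)"
    using assms reduce(2) by (metis wf_stack_Inl)
  then show ?thesis
    using reduce wf_smul piece_unit wf_stack_append by metis
qed (use assms in simp)

lemma wf_act: "w \<in> lists A \<Longrightarrow> wf_stack x \<Longrightarrow> wf_stack (act w x)"
  by (induction w) (auto simp: wf_push)

text \<open>
  No reduction happens while a proper suffix of a piece is pushed, whatever the stack: a piece on top
  would start inside the given piece, but not at its first letter.
\<close>

lemma act_proper_suffix:
  assumes "p @ s \<in> \<Delta>" "p \<noteq> []"
  shows "act s x = map Inl s @ x"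
  using assms
proof (induction s arbitrary: p)
  case (Cons c s)
  have IH: "act s x = map Inl s @ x"
    using Cons.IH[of "p @ [c]"] Cons.prems by simp
  have "Inl c # map Inl s @ x \<noteq> map Inl \<eta> @ z" if "\<eta> \<in> \<Delta>" for \<eta> z
  proof
    assume "Inl c # map Inl s @ x = map Inl \<eta> @ z"
    then have "map Inl p @ map Inl \<eta> @ z = map Inl (p @ c # s) @ x"
      by simp
    from occurrence_unique[OF this \<open>\<eta> \<in> \<Delta>\<close> Cons.prems(1)] show False
      using Cons.prems by simp
  qed
  then show ?case
    using IH by (simp add: push_stay)
qed simp

text \<open>
  Only the first letter of the piece, which is pushed last, triggers a reduction.
\<close>

lemma act_piece:
  assumes "\<delta> \<in> \<Delta>"
  shows "act \<delta> x = smul (cls \<delta>) x"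
proof -
  obtain c s where cs: "\<delta> = c # s"
    using piece_nonempty[OF assms] by (cases \<delta>) auto
  then have "act s x = map Inl s @ x"
    using act_proper_suffix[of "[c]" s] assms by simp
  then show ?thesis
    using push_reduce[OF assms, of c "map Inl s @ x" x] cs by simp
qed

lemma act_pieces:
  assumes "set ds \<subseteq> \<Delta>" "wf_stack x"
  shows "cls (concat ds) \<in> Units M \<and> act (concat ds) x = smul (cls (concat ds)) x"
  using assms(1)
proof (induction ds)
  case Nil
  then show ?case
    using assms(2) smul_one one_M by (metis M.Units_one_closed act_simps(1) concat.simps(1))
next
  case (Cons d ds)
  have "concat ds \<in> lists A" "d \<in> lists A"
    using Cons.prems piece_lists concat_pieces_lists by auto
  then have "cls (d @ concat ds) = cls d \<otimes>\<^bsub>M\<^esub> cls (concat ds)"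
    by (simp add: mult_M)
  then show ?case
    using Cons piece_unit[of d] assms(2) by (simp add: act_piece smul_smul)
qed

lemma act_relator: "wf_stack x \<Longrightarrow> act r x = x"
  using act_pieces[of rs x] concat_rs pieces smul_one cls_r by simp

text \<open>
  Hence the well-formed stacks carry an action of \<open>M\<close>, and \<^term>\<open>act w []\<close> depends only on the class of \<open>w\<close>.
\<close>

lemma act_cong:
  assumes "(u, v) \<in> pres_cong A {(r, [])}" "wf_stack x"
  shows "act u x = act v x"
  using assms by (induction arbitrary: x) (auto simp: act_relator wf_act)

lemma act_cls_eq:
  assumes "cls u = cls v" "u \<in> lists A" "wf_stack x"
  shows "act u x = act v x"
  using assms act_cong pres_class_eq_iff by metis

text \<open>
  The element of \<open>M\<close> that a stack stands for; \<open>val_act_Nil\<close> says that the normal form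
  \<^term>\<open>act w []\<close> determines the class of \<open>w\<close>.
\<close>

fun val :: "'a stack \<Rightarrow> 'a list set" where
  "val [] = \<one>\<^bsub>M\<^esub>"
| "val (Inl c # x) = cls [c] \<otimes>\<^bsub>M\<^esub> val x"
| "val (Inr g # x) = g \<otimes>\<^bsub>M\<^esub> val x"

lemma val_closed: "wf_stack x \<Longrightarrow> val x \<in> carrier M"
  by (induction x rule: val.induct) (auto simp: wf_stack_Inr)

lemma val_append_word:
  assumes "w \<in> lists A" "wf_stack x"
  shows "val (map Inl w @ x) = cls w \<otimes>\<^bsub>M\<^esub> val x"
  using assms(1)
proof (induction w rule: list.induct)
  case (Cons c w)
  have "cls (c # w) = cls [c] \<otimes>\<^bsub>M\<^esub> cls w"
    using Cons.prems by (simp add: mult_M)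
  then show ?case
    using Cons assms(2) by (simp add: M.m_assoc cls_closed val_closed)
qed (use assms(2) in \<open>simp add: one_M[symmetric] val_closed\<close>)

lemma val_smul:
  assumes "wf_stack x" "g \<in> Units M"
  shows "val (smul g x) = g \<otimes>\<^bsub>M\<^esub> val x"
proof (cases "x = [] \<or> isl (hd x)")
  case True
  then show ?thesis
    using assms val_closed by (auto simp: smul_head)
next
  case False
  then obtain k y where x: "x = Inr k # y"
    by (cases x; cases "hd x") auto
  with assms have k: "k \<in> Units M" "wf_stack y"
    by (auto simp: wf_stack_Inr)
  then have "g \<otimes>\<^bsub>M\<^esub> (k \<otimes>\<^bsub>M\<^esub> val y) = g \<otimes>\<^bsub>M\<^esub> k \<otimes>\<^bsub>M\<^esub> val y"
    using assms val_closed by (simp add: M.m_assoc M.Units_closed)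
  then show ?thesis
    using x k val_closed by auto
qed

lemma val_push:
  assumes "wf_stack x" "c \<in> A"
  shows "val (push c x) = cls [c] \<otimes>\<^bsub>M\<^esub> val x"
proof (cases c x rule: push_cases)
  case (reduce \<delta> z)
  have "wf_stack z"
    using assms reduce(2) by (metis wf_stack_Inl wf_stack_append)
  then have "val (push c x) = val (map Inl \<delta> @ z)"
    using reduce val_smul piece_unit piece_lists val_append_word by simp
  then show ?thesis
    using reduce(2) by (metis val.simps(2))
qed simp

lemma val_act_Nil: "w \<in> lists A \<Longrightarrow> val (act w []) = cls w"
proof (induction w)
  case (Cons c w)
  then show ?case
    using val_push[of "act w []" c] by (simp add: wf_act mult_M)
qed (simp add: one_M)

end

section \<open>Right inverses of the powers of the common first letter\<close>

lemma replicate_lists: "c \<in> A \<Longrightarrow> replicate n c \<in> lists A"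
  by (induction n) auto

lemma Cons_eq_snoc_replicate: "c # x = x @ [c] \<Longrightarrow> x = replicate (length x) c"
  by (induction x) auto

locale branching_pieces = minimal_pieces +
  fixes a :: 'a and \<gamma> \<delta> :: "'a list"
  assumes branch: "\<gamma> \<in> \<Delta>" "\<delta> \<in> \<Delta>" "\<gamma> \<noteq> \<delta>" "prefix [a] \<gamma>" "prefix [a] \<delta>"
begin

lemma a_in_A: "a \<in> A"
  using piece_lists[OF branch(1)] branch(4) by (auto simp: prefix_def)

text \<open>
  Such a piece would overlap in its last letter with \<open>\<gamma>\<close> and with \<open>\<delta>\<close>, so both would be equal to it.
\<close>

lemma piece_does_not_end_in_a: "p @ [a] \<notin> \<Delta>"
proof
  assume *: "p @ [a] \<in> \<Delta>"
  have "\<epsilon> = p @ [a]" if e: "\<epsilon> \<in> \<Delta>" "prefix [a] \<epsilon>" for \<epsilon>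
  proof -
    obtain t where "\<epsilon> = a # t"
      using e(2) by (auto simp: prefix_def)
    then have "map Inl p @ map Inl \<epsilon> @ [] = map Inl (p @ [a]) @ (map Inl t :: 'a stack)"
      by simp
    from occurrence_unique[OF this e(1) *] show ?thesis
      by simp
  qed
  then show False
    using branch by metis
qed

lemma replicate_not_piece: "replicate k a \<notin> \<Delta>"
proof (cases k)
  case 0
  then show ?thesis
    using piece_nonempty by auto
next
  case (Suc m)
  then have "replicate k a = replicate m a @ [a]"
    by (simp add: replicate_append_same)
  then show ?thesis
    using piece_does_not_end_in_a by metis
qed

lemma smul_snoc: "smul g (x @ [Inl a]) = smul g x @ [Inl a]"
  by (cases "(g, x)" rule: smul.cases) auto

text \<open>
  An \<open>a\<close> at the bottom of the stack is inert, as it cannot be the end of a piece.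
\<close>

lemma push_snoc: "push c (x @ [Inl a]) = push c x @ [Inl a]"
proof (cases c x rule: push_cases)
  case (reduce \<epsilon> z)
  then show ?thesis
    using push_reduce[of \<epsilon> c "x @ [Inl a]" "z @ [Inl a]"] by (simp add: smul_snoc)
next
  case stay
  have "Inl c # x @ [Inl a] \<noteq> map Inl \<epsilon> @ z" if "\<epsilon> \<in> \<Delta>" for \<epsilon> z
  proof
    assume *: "Inl c # x @ [Inl a] = map Inl \<epsilon> @ z"
    show False
    proof (cases z rule: rev_cases)
      case Nil
      then have "map Inl \<epsilon> = (Inl c # x) @ [Inl a]"
        using * by simp
      then obtain p where "\<epsilon> = p @ [a]"
        by (auto simp: map_eq_append_conv map_eq_Cons_conv)
      then show False
        using piece_does_not_end_in_a that by simp
    next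
      case (snoc z' e)
      then have "Inl c # x = map Inl \<epsilon> @ z'"
        using * by (metis append_Cons append_assoc append1_eq_conv)
      then show False
        using stay that by simp
    qed
  qed
  then show ?thesis
    using push_stay stay by simp
qed

lemma act_snoc: "act w (x @ [Inl a]) = act w x @ [Inl a]"
  by (induction w) (simp_all add: push_snoc)

lemma act_replicate_a: "act (replicate n a) [] = replicate n (Inl a)"
proof (induction n)
  case (Suc n)
  have "act [a] [] = [Inl a]"
  proof -
    have "[Inl a] \<noteq> map Inl \<epsilon> @ z" if "\<epsilon> \<in> \<Delta>" for \<epsilon> and z :: "'a stack"
      using that piece_nonempty[of \<epsilon>] piece_does_not_end_in_a[of "[]"]
      by (cases \<epsilon>) auto
    then show ?thesis
      by (simp add: push_stay)
  qed
  then have "act (replicate n a @ [a]) [] = act (replicate n a) ([] @ [Inl a])"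
    by (simp only: act_simps append_Nil)
  then have "act (replicate n a @ [a]) [] = replicate n (Inl a) @ [Inl a]"
    by (simp only: act_snoc Suc.IH)
  then show ?case
    by (simp add: replicate_append_same)
qed simp

lemma cls_a_pow: "cls [a] [^]\<^bsub>M\<^esub> n = cls (replicate n a)"
proof -
  have "concat (replicate n [a]) = replicate n a"
    by (induction n) auto
  then show ?thesis
    using cls_pow[of "[a]" n] a_in_A by simp
qed

lemma inj_cls_a_pow: "cls [a] [^]\<^bsub>M\<^esub> (m::nat) = cls [a] [^]\<^bsub>M\<^esub> (n::nat) \<Longrightarrow> m = n"
proof -
  assume "cls [a] [^]\<^bsub>M\<^esub> m = cls [a] [^]\<^bsub>M\<^esub> n"
  then have "act (replicate m a) [] = act (replicate n a) []"
    by (intro act_cls_eq) (auto simp: cls_a_pow replicate_lists a_in_A)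
  then have "length (replicate m (Inl a :: 'a + 'a list set)) = length (replicate n (Inl a :: 'a + 'a list set))"
    by (simp only: act_replicate_a)
  then show ?thesis
    by simp
qed

lemma length_smul: "length (smul g x) \<le> Suc (length x)"
  by (cases "(g, x)" rule: smul.cases) auto

text \<open>
  Let \<open>X\<close> be the normal form of \<open>x\<close>. The normal form of \<open>x \<otimes> \<alpha>\<close> is \<open>X\<close> with an \<open>a\<close> added at the
  bottom, that of \<open>\<alpha> \<otimes> x\<close> arises by pushing \<open>a\<close> onto \<open>X\<close>. A reduction in the latter would make it too
  short; without one, all entries of \<open>X\<close> equal \<open>a\<close>.
\<close>

lemma centralizer_of_a:
  assumes "x \<in> carrier M" "x \<otimes>\<^bsub>M\<^esub> cls [a] = cls [a] \<otimes>\<^bsub>M\<^esub> x"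
  shows "\<exists>n::nat. x = cls [a] [^]\<^bsub>M\<^esub> n"
proof -
  obtain w where w: "w \<in> lists A" "x = cls w"
    using assms(1) carrier_M by auto
  define X where "X = act w []"
  have "cls (w @ [a]) = cls (a # w)"
    using assms(2) w a_in_A by (simp add: mult_M)
  then have "act (w @ [a]) [] = act (a # w) []"
    using w a_in_A by (intro act_cls_eq) auto
  moreover have "act (w @ [a]) [] = X @ [Inl a]"
    using act_replicate_a[of 1] act_snoc[of w "[]"] by (simp add: X_def)
  ultimately have X: "X @ [Inl a] = push a X"
    by (simp add: X_def)
  show ?thesis
  proof (cases a X rule: push_cases)
    case (reduce \<epsilon> z)
    have "\<epsilon> \<noteq> []" "\<epsilon> \<noteq> [a]"
      using reduce(1) piece_nonempty piece_does_not_end_in_a[of "[]"] by auto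
    moreover have "hd \<epsilon> = a"
      using reduce(2) \<open>\<epsilon> \<noteq> []\<close> by (cases \<epsilon>) auto
    ultimately have "length \<epsilon> \<ge> 2"
      by (cases \<epsilon>; cases "tl \<epsilon>") auto
    moreover have "Suc (length X) = length \<epsilon> + length z"
      using arg_cong[OF reduce(2), of length] by simp
    moreover have "length (X @ [Inl a]) \<le> Suc (length z)"
      unfolding X reduce(3) by (rule length_smul)
    ultimately show ?thesis
      by simp
  next
    case stay
    have "X = replicate (length X) (Inl a)"
      using stay(2) X by (intro Cons_eq_snoc_replicate) simp
    then have "X = map Inl (replicate (length X) a)"
      by simp
    then have "val X = cls (replicate (length X) a) \<otimes>\<^bsub>M\<^esub> val []"
      using val_append_word[of "replicate (length X) a" "[]"] replicate_lists[OF a_in_A] by simp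
    then show ?thesis
      using val_act_Nil[OF w(1)] w(2) cls_a_pow replicate_lists[OF a_in_A]
      by (metis M.r_one X_def cls_closed val.simps(1))
  qed
qed

text \<open>
  The pair \<open>(\<epsilon>, j)\<close> stands for the element \<open>s \<epsilon>\<inverse>\<close> with \<open>\<epsilon> = a\<^sup>j s\<close>, a right inverse of \<open>\<alpha>\<^sup>j\<close>. A piece
  that starts with several letters \<open>a\<close> contributes one generator for each \<open>j\<close>.
\<close>

definition generators :: "('a list \<times> nat) set" where
  "generators = {(\<epsilon>, j). \<epsilon> \<in> \<Delta> \<and> 1 \<le> j \<and> prefix (replicate j a) \<epsilon>}"

definition inverse_word :: "'a list \<Rightarrow> 'a list" where
  "inverse_word \<epsilon> = (SOME v. v \<in> lists A \<and> cls \<epsilon> \<otimes>\<^bsub>M\<^esub> cls v = \<one>\<^bsub>M\<^esub> \<and> cls v \<otimes>\<^bsub>M\<^esub> cls \<epsilon> = \<one>\<^bsub>M\<^esub>)"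

definition generator_word :: "'a list \<times> nat \<Rightarrow> 'a list" where
  "generator_word = (\<lambda>(\<epsilon>, j). drop j \<epsilon> @ inverse_word \<epsilon>)"

lemma inverse_word:
  assumes "\<epsilon> \<in> \<Delta>"
  shows "inverse_word \<epsilon> \<in> lists A" "cls (\<epsilon> @ inverse_word \<epsilon>) = \<one>\<^bsub>M\<^esub>"
    "cls (inverse_word \<epsilon> @ \<epsilon>) = \<one>\<^bsub>M\<^esub>"
proof -
  obtain y where "y \<in> carrier M" "cls \<epsilon> \<otimes>\<^bsub>M\<^esub> y = \<one>\<^bsub>M\<^esub>" "y \<otimes>\<^bsub>M\<^esub> cls \<epsilon> = \<one>\<^bsub>M\<^esub>"
    using piece_unit[OF assms] by (auto simp: Units_def)
  then have "\<exists>v. v \<in> lists A \<and> cls \<epsilon> \<otimes>\<^bsub>M\<^esub> cls v = \<one>\<^bsub>M\<^esub> \<and> cls v \<otimes>\<^bsub>M\<^esub> cls \<epsilon> = \<one>\<^bsub>M\<^esub>"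
    using carrier_M by auto
  from someI_ex[OF this] have *: "inverse_word \<epsilon> \<in> lists A"
    "cls \<epsilon> \<otimes>\<^bsub>M\<^esub> cls (inverse_word \<epsilon>) = \<one>\<^bsub>M\<^esub>" "cls (inverse_word \<epsilon>) \<otimes>\<^bsub>M\<^esub> cls \<epsilon> = \<one>\<^bsub>M\<^esub>"
    unfolding inverse_word_def by blast+
  then show "inverse_word \<epsilon> \<in> lists A" "cls (\<epsilon> @ inverse_word \<epsilon>) = \<one>\<^bsub>M\<^esub>"
    "cls (inverse_word \<epsilon> @ \<epsilon>) = \<one>\<^bsub>M\<^esub>"
    using piece_lists[OF assms] by (simp_all add: mult_M)
qed

lemma generatorsD:
  assumes "(\<epsilon>, j) \<in> generators"
  shows "\<epsilon> \<in> \<Delta>" "1 \<le> j" "\<epsilon> = replicate j a @ drop j \<epsilon>" "drop j \<epsilon> \<noteq> []" "drop j \<epsilon> \<in> lists A"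
proof -
  show *: "\<epsilon> \<in> \<Delta>" "1 \<le> j"
    using assms by (auto simp: generators_def)
  obtain t where t: "\<epsilon> = replicate j a @ t"
    using assms by (auto simp: generators_def prefix_def)
  then show "\<epsilon> = replicate j a @ drop j \<epsilon>"
    by simp
  show "drop j \<epsilon> \<noteq> []"
    using t * replicate_not_piece[of j] by auto
  show "drop j \<epsilon> \<in> lists A"
    using t piece_lists[OF *(1)] by auto
qed

lemma generator_word_lists: "p \<in> generators \<Longrightarrow> generator_word p \<in> lists A"
  by (cases p) (auto simp: generator_word_def generatorsD(1,5) inverse_word)

lemma concat_generator_words_lists:
  "set ps \<subseteq> generators \<Longrightarrow> concat (map generator_word ps) \<in> lists A"
  by (induction ps) (auto simp: generator_word_lists)

lemma finite_generators: "finite generators"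
proof (rule finite_subset)
  show "generators \<subseteq> (SIGMA \<epsilon>:\<Delta>. {..length \<epsilon>})"
    by (auto simp: generators_def dest: prefix_length_le)
  show "finite (SIGMA \<epsilon>:\<Delta>. {..length \<epsilon>})"
    by (simp add: pieces)
qed

lemma card_generators: "card generators \<ge> 2"
proof -
  have "{(\<gamma>, 1), (\<delta>, 1)} \<subseteq> generators"
    using branch by (simp add: generators_def)
  from card_mono[OF finite_generators this] show ?thesis
    using branch by simp
qed

lemma act_replicate_a_stay:
  assumes "\<And>i \<epsilon> z. 1 \<le> i \<Longrightarrow> i \<le> m \<Longrightarrow> \<epsilon> \<in> \<Delta> \<Longrightarrow> replicate i (Inl a) @ x \<noteq> map Inl \<epsilon> @ z"
  shows "act (replicate m a) x = replicate m (Inl a) @ x"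
  using assms
proof (induction m)
  case (Suc m)
  have "act (replicate m a) x = replicate m (Inl a) @ x"
    using Suc.IH Suc.prems by auto
  moreover have "push a (replicate m (Inl a) @ x) = Inl a # replicate m (Inl a) @ x"
    using Suc.prems[of "Suc m"] by (intro push_stay) simp
  ultimately show ?case
    by simp
qed simp

text \<open>
  Pushing letters \<open>a\<close> can only empty a nonempty stack if a reduction occurs. At the first one, after
  \<open>j\<close> letters, a piece lies on top; it uses all \<open>j\<close> letters, since it is not a power of \<open>a\<close>.
\<close>

lemma first_reduction:
  assumes "act (replicate n a) x = []" "n > 0"
  obtains \<epsilon> j z where "(\<epsilon>, j) \<in> generators" "j \<le> n" "x = map Inl (drop j \<epsilon>) @ z"
    "act (replicate (n - j) a) (smul (cls \<epsilon>) z) = []"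
proof -
  \<comment> \<open>the \<open>j\<close>-th letter \<open>a\<close> completes a piece on top, if no earlier one does\<close>
  define P where "P j \<longleftrightarrow> 1 \<le> j \<and> (\<exists>\<epsilon>\<in>\<Delta>. \<exists>z. replicate j (Inl a) @ x = map Inl \<epsilon> @ z)" for j
  have "\<exists>j\<le>n. P j"
  proof (rule ccontr)
    assume "\<not> (\<exists>j\<le>n. P j)"
    then have "act (replicate n a) x = replicate n (Inl a) @ x"
      unfolding P_def by (intro act_replicate_a_stay) blast
    then show False
      using assms by simp
  qed
  then obtain j where j: "j \<le> n" "P j" and least: "\<And>i. i < j \<Longrightarrow> \<not> P i"
    using exists_least_iff[of P] by (metis nless_le order_trans linorder_not_le)
  from j(2) obtain \<epsilon> z where ez: "1 \<le> j" "\<epsilon> \<in> \<Delta>" "replicate j (Inl a) @ x = map Inl \<epsilon> @ z"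
    unfolding P_def by blast
  obtain i where i: "j = Suc i"
    using ez(1) by (cases j) auto
  have "act (replicate i a) x = replicate i (Inl a) @ x"
  proof (rule act_replicate_a_stay)
    fix k \<epsilon>' and z' :: "'a stack"
    assume "1 \<le> k" "k \<le> i" "\<epsilon>' \<in> \<Delta>"
    then show "replicate k (Inl a) @ x \<noteq> map Inl \<epsilon>' @ z'"
      using least[of k] i unfolding P_def by auto
  qed
  then have red: "act (replicate j a) x = smul (cls \<epsilon>) z"
    using push_reduce[OF ez(2), of a _ z] ez(3) i by simp
  have "prefix (replicate j a) \<epsilon>"
  proof -
    from ez(3) consider us where "map Inl \<epsilon> = replicate j (Inl a) @ (us :: 'a stack)"
      | us where "replicate j (Inl a) = map Inl \<epsilon> @ (us :: 'a stack)"
      using append_eq_append_conv2[THEN iffD1, OF ez(3)] by metis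
    then show ?thesis
    proof cases
      case 1
      then have "take j (map Inl \<epsilon>) = replicate j (Inl a :: 'a + 'a list set)"
        by simp
      then have "map Inl (take j \<epsilon>) = (map Inl (replicate j a) :: 'a stack)"
        by (simp add: take_map)
      then show ?thesis
        by (metis inj_map_eq_map inj_Inl take_is_prefix)
    next
      case 2
      then have "take (length \<epsilon>) (replicate j (Inl a)) = (map Inl \<epsilon> :: 'a stack)"
        by simp
      then have "map Inl \<epsilon> = (map Inl (replicate (min (length \<epsilon>) j) a) :: 'a stack)"
        by simp
      then have "\<epsilon> = replicate (min (length \<epsilon>) j) a"
        by (metis inj_map_eq_map inj_Inl)
      then show ?thesis
        using replicate_not_piece ez(2) by metis
    qed
  qed
  then have gen: "(\<epsilon>, j) \<in> generators"
    using ez by (simp add: generators_def)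
  have "x = map Inl (drop j \<epsilon>) @ z"
  proof -
    have "replicate j (Inl a) @ x = replicate j (Inl a) @ map Inl (drop j \<epsilon>) @ z"
      using ez(3) arg_cong[OF generatorsD(3)[OF gen], of "map Inl :: _ \<Rightarrow> 'a stack"] by simp
    then show ?thesis
      by simp
  qed
  moreover have "act (replicate (n - j) a) (smul (cls \<epsilon>) z) = []"
  proof -
    have "replicate n a = replicate (n - j) a @ replicate j a"
      using j(1) by (simp flip: replicate_add)
    then show ?thesis
      using assms(1) red by simp
  qed
  ultimately show ?thesis
    using that gen j(1) by blast
qed

text \<open>
  If \<open>x = s z\<close> as in \<open>first_reduction\<close>, then the value of \<open>x\<close> is that of \<open>s \<epsilon>\<inverse>\<close> times that of
  \<^term>\<open>smul (cls \<epsilon>) z\<close>, and the latter stack is emptied by fewer letters.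
\<close>

lemma right_inverse_factors:
  assumes "act (replicate n a) x = []" "wf_stack x"
  shows "\<exists>ps. set ps \<subseteq> generators \<and> val x = cls (concat (map generator_word ps)) \<and> n = sum_list (map snd ps)"
  using assms
proof (induction n arbitrary: x rule: less_induct)
  case (less n)
  show ?case
  proof (cases "n = 0")
    case True
    then show ?thesis
      using less.prems by (intro exI[of _ "[]"]) (simp add: one_M)
  next
    case False
    then obtain \<epsilon> j z where gen: "(\<epsilon>, j) \<in> generators" and j: "j \<le> n" and x: "x = map Inl (drop j \<epsilon>) @ z"
      and rest: "act (replicate (n - j) a) (smul (cls \<epsilon>) z) = []"
      using first_reduction[OF less.prems(1)] by blast
    note gen' = generatorsD[OF gen]
    have z: "wf_stack z"
      using less.prems(2) x wf_stack_append by blast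
    then obtain ps where ps: "set ps \<subseteq> generators"
      "val (smul (cls \<epsilon>) z) = cls (concat (map generator_word ps))" "n - j = sum_list (map snd ps)"
      using less.IH[OF _ rest] wf_smul[OF z piece_unit[OF gen'(1)]] gen'(2) j by auto
    have e: "\<epsilon> \<in> lists A" "inverse_word \<epsilon> \<in> lists A"
      using gen'(1) piece_lists inverse_word by auto
    have "cls (concat (map generator_word ((\<epsilon>, j) # ps)))
        = cls (drop j \<epsilon>) \<otimes>\<^bsub>M\<^esub> (cls (inverse_word \<epsilon>) \<otimes>\<^bsub>M\<^esub> cls (concat (map generator_word ps)))"
      using gen'(5) e concat_generator_words_lists[OF ps(1)]
      by (simp add: generator_word_def mult_M)
    also have "\<dots> = cls (drop j \<epsilon>) \<otimes>\<^bsub>M\<^esub> (cls (inverse_word \<epsilon>) \<otimes>\<^bsub>M\<^esub> (cls \<epsilon> \<otimes>\<^bsub>M\<^esub> val z))"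
      using ps(2) val_smul[OF z piece_unit[OF gen'(1)]] by simp
    also have "cls (inverse_word \<epsilon>) \<otimes>\<^bsub>M\<^esub> (cls \<epsilon> \<otimes>\<^bsub>M\<^esub> val z) = cls (inverse_word \<epsilon> @ \<epsilon>) \<otimes>\<^bsub>M\<^esub> val z"
      using e val_closed[OF z] by (simp add: M.m_assoc[symmetric] cls_closed mult_M)
    also have "\<dots> = val z"
      using inverse_word(3)[OF gen'(1)] val_closed[OF z] by simp
    also have "cls (drop j \<epsilon>) \<otimes>\<^bsub>M\<^esub> val z = val x"
      using x val_append_word[OF gen'(5) z] by simp
    finally show ?thesis
      using gen ps j by (intro exI[of _ "(\<epsilon>, j) # ps"]) auto
  qed
qed

lemma pow_a_right_inverse:
  assumes "set ps \<subseteq> generators"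
  shows "cls [a] [^]\<^bsub>M\<^esub> sum_list (map snd ps) \<otimes>\<^bsub>M\<^esub> cls (concat (map generator_word ps)) = \<one>\<^bsub>M\<^esub>"
  using assms
proof (induction ps)
  case Nil
  then show ?case
    using cls_closed[of "[]"] by (simp add: one_M[symmetric])
next
  case (Cons p ps)
  obtain \<epsilon> j where p: "p = (\<epsilon>, j)"
    by (cases p)
  then have gen: "(\<epsilon>, j) \<in> generators"
    using Cons.prems by simp
  note gen' = generatorsD[OF gen]
  let ?k = "sum_list (map snd ps)" and ?w = "concat (map generator_word ps)"
  have l: "?w \<in> lists A" "\<epsilon> \<in> lists A" "inverse_word \<epsilon> \<in> lists A"
    using Cons.prems gen'(1) piece_lists inverse_word concat_generator_words_lists by auto
  have a: "cls [a] \<in> carrier M"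
    using a_in_A by auto
  have "cls [a] [^]\<^bsub>M\<^esub> j \<otimes>\<^bsub>M\<^esub> cls (generator_word p @ ?w)
      = cls (replicate j a @ drop j \<epsilon>) \<otimes>\<^bsub>M\<^esub> cls (inverse_word \<epsilon> @ ?w)"
    using gen'(5) l p replicate_lists[OF a_in_A] by (simp add: cls_a_pow generator_word_def mult_M)
  also have "\<dots> = cls (\<epsilon> @ inverse_word \<epsilon>) \<otimes>\<^bsub>M\<^esub> cls ?w"
    using l by (simp add: mult_M flip: gen'(3))
  also have "\<dots> = cls ?w"
    using inverse_word(2)[OF gen'(1)] l by (simp add: cls_closed)
  finally have step: "cls [a] [^]\<^bsub>M\<^esub> j \<otimes>\<^bsub>M\<^esub> cls (generator_word p @ ?w) = cls ?w" .
  have "cls [a] [^]\<^bsub>M\<^esub> (?k + j) \<otimes>\<^bsub>M\<^esub> cls (generator_word p @ ?w)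
      = cls [a] [^]\<^bsub>M\<^esub> ?k \<otimes>\<^bsub>M\<^esub> (cls [a] [^]\<^bsub>M\<^esub> j \<otimes>\<^bsub>M\<^esub> cls (generator_word p @ ?w))"
    using a l generator_word_lists Cons.prems
    by (simp add: M.nat_pow_mult[symmetric] M.m_assoc cls_closed)
  then show ?case
    using Cons step p by (simp add: add.commute)
qed

text \<open>
  If \<open>j < j'\<close>, then pushing \<open>j'\<close> letters \<open>a\<close> would put \<open>\<epsilon>'\<close> on top while \<open>\<epsilon>\<close> occurs inside
  or overlaps with it, shifted by \<open>j' - j\<close> letters.
\<close>

lemma first_factor_unique:
  fixes z z' :: "'a stack"
  assumes "(\<epsilon>, j) \<in> generators" "(\<epsilon>', j') \<in> generators"
    and "map Inl (drop j \<epsilon>) @ z = map Inl (drop j' \<epsilon>') @ z'"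
  shows "(\<epsilon>, j) = (\<epsilon>', j') \<and> z = z'"
  using assms
proof (induction j j' arbitrary: \<epsilon> \<epsilon>' z z' rule: linorder_wlog)
  case (le j j')
  note g = generatorsD[OF le(2)] and g' = generatorsD[OF le(3)]
  have "map Inl (replicate (j' - j) a) @ map Inl \<epsilon> @ z
      = map Inl (replicate (j' - j) a @ replicate j a) @ map Inl (drop j \<epsilon>) @ z"
    unfolding map_append[symmetric] append_assoc[symmetric] by (simp flip: g(3))
  also have "\<dots> = map Inl (replicate j' a) @ map Inl (drop j' \<epsilon>') @ z'"
    using le(1) le(4) by (simp flip: replicate_add)
  also have "\<dots> = map Inl \<epsilon>' @ z'"
    unfolding map_append[symmetric] append_assoc[symmetric] by (simp flip: g'(3))
  finally have *: "map Inl (replicate (j' - j) a) @ map Inl \<epsilon> @ z = map Inl \<epsilon>' @ z'" .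
  have "length \<epsilon>' \<ge> j'"
    using g'(3) by (metis length_append length_replicate le_add1)
  then have "length (map Inl (replicate (j' - j) a) :: 'a stack) < length \<epsilon>'"
    using g(2) le(1) g'(4) by simp
  from occurrence_unique[OF * g(1) g'(1) this] show ?case
    using le(1) by simp
next
  case (sym j j')
  from sym(1)[OF sym(3,2) sym(4)[symmetric]] show ?case
    by simp
qed

text \<open>
  The stack \<open>z\<close> is the one for \<open>\<epsilon>\<inverse>\<close> times the rest of the product; multiplying it by \<open>\<epsilon>\<close> recovers the
  rest.
\<close>

lemma normal_form_of_product:
  assumes "(\<epsilon>, j) \<in> generators" "set ps \<subseteq> generators"
  obtains z where "act (concat (map generator_word ((\<epsilon>, j) # ps))) [] = map Inl (drop j \<epsilon>) @ z"
    "smul (cls \<epsilon>) z = act (concat (map generator_word ps)) []"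
proof
  note gen = generatorsD[OF assms(1)]
  let ?w = "concat (map generator_word ps)"
  let ?z = "act (inverse_word \<epsilon> @ ?w) []"
  have wf: "wf_stack (act ?w [])"
    using assms(2) by (simp add: wf_act concat_generator_words_lists)
  have "act (drop j \<epsilon>) ?z = map Inl (drop j \<epsilon>) @ ?z"
    using gen(1,2) by (intro act_proper_suffix[of "replicate j a"]) (simp_all flip: gen(3))
  then show "act (concat (map generator_word ((\<epsilon>, j) # ps))) [] = map Inl (drop j \<epsilon>) @ ?z"
    by (simp add: generator_word_def)
  have "smul (cls \<epsilon>) ?z = act (\<epsilon> @ inverse_word \<epsilon>) (act ?w [])"
    by (simp add: act_piece[OF gen(1), symmetric])
  also have "\<dots> = act [] (act ?w [])"
    using inverse_word[OF gen(1)] piece_lists[OF gen(1)] wf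
    by (intro act_cls_eq) (auto simp: one_M)
  finally show "smul (cls \<epsilon>) ?z = act ?w []"
    by simp
qed

text \<open>
  By \<open>normal_form_of_product\<close> the normal form of a product starts with the remainder of the piece of
  its first factor, from which \<open>first_factor_unique\<close> reads off the factor.
\<close>

lemma generators_free:
  assumes "set ps \<subseteq> generators" "set qs \<subseteq> generators"
    and "cls (concat (map generator_word ps)) = cls (concat (map generator_word qs))"
  shows "ps = qs"
proof -
  have "act (concat (map generator_word ps)) [] = act (concat (map generator_word qs)) []"
    using assms by (intro act_cls_eq) (auto simp: concat_generator_words_lists)
  with assms(1,2) show ?thesis
  proof (induction ps arbitrary: qs)
    case Nil
    show ?case
    proof (cases qs)
      case (Cons q qs')
      obtain \<epsilon> j where q: "q = (\<epsilon>, j)"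
        by (cases q)
      have "(\<epsilon>, j) \<in> generators" "set qs' \<subseteq> generators"
        using Nil.prems(2) Cons q by auto
      from generatorsD(4)[OF this(1)] normal_form_of_product[OF this] show ?thesis
        using Nil.prems(3) Cons q by (metis Nil_is_append_conv Nil_is_map_conv act_simps(1) concat.simps(1))
    qed simp
  next
    case (Cons p ps)
    obtain \<epsilon> j where p: "p = (\<epsilon>, j)"
      by (cases p)
    have gen: "(\<epsilon>, j) \<in> generators" "set ps \<subseteq> generators"
      using Cons.prems(1) p by auto
    obtain z where z: "act (concat (map generator_word (p # ps))) [] = map Inl (drop j \<epsilon>) @ z"
      "smul (cls \<epsilon>) z = act (concat (map generator_word ps)) []"
      using normal_form_of_product[OF gen] p by metis
    show ?case
    proof (cases qs)
      case Nil
      then have "map Inl (drop j \<epsilon>) @ z = []"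
        using z(1) Cons.prems(3) by simp
      then show ?thesis
        using generatorsD(4)[OF gen(1)] by simp
    next
      case qs: (Cons q qs')
      obtain \<epsilon>' j' where q: "q = (\<epsilon>', j')"
        by (cases q)
      have gen': "(\<epsilon>', j') \<in> generators" "set qs' \<subseteq> generators"
        using Cons.prems(2) q qs by auto
      obtain z' where z': "act (concat (map generator_word (q # qs'))) [] = map Inl (drop j' \<epsilon>') @ z'"
        "smul (cls \<epsilon>') z' = act (concat (map generator_word qs')) []"
        using normal_form_of_product[OF gen'] q by metis
      have "map Inl (drop j \<epsilon>) @ z = map Inl (drop j' \<epsilon>') @ z'"
        using z(1) z'(1) Cons.prems(3) qs by (simp only:)
      then have eq: "(\<epsilon>, j) = (\<epsilon>', j')" "z = z'"
        using first_factor_unique[OF gen(1) gen'(1)] by blast+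
      then have "act (concat (map generator_word ps)) [] = act (concat (map generator_word qs')) []"
        using z(2) z'(2) by simp
      then show ?thesis
        using Cons.IH[OF gen(2) gen'(2)] eq p q qs by simp
    qed
  qed
qed

lemma pow_a_right_inverse_iff:
  assumes "y \<in> carrier M"
  shows "cls [a] [^]\<^bsub>M\<^esub> (k::nat) \<otimes>\<^bsub>M\<^esub> y = \<one>\<^bsub>M\<^esub> \<longleftrightarrow>
    (\<exists>ps. set ps \<subseteq> generators \<and> y = cls (concat (map generator_word ps)) \<and> k = sum_list (map snd ps))"
    (is "?L \<longleftrightarrow> ?R")
proof
  assume ?L
  obtain w where w: "w \<in> lists A" "y = cls w"
    using assms carrier_M by auto
  have "cls (replicate k a @ w) = cls []"
    using \<open>?L\<close> w replicate_lists[OF a_in_A] by (simp add: cls_a_pow mult_M one_M)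
  then have "act (replicate k a @ w) [] = act [] []"
    using w replicate_lists[OF a_in_A] by (intro act_cls_eq) auto
  then show ?R
    using right_inverse_factors[of k "act w []"] w by (simp add: wf_act val_act_Nil)
next
  assume ?R
  then show ?L
    using pow_a_right_inverse by blast
qed

end

section \<open>Interpreting free monoids with a length relation\<close>

lemma word_val_Nil [simp]: "word_val M \<iota> \<sigma> [] = \<one>\<^bsub>M\<^esub>"
  and word_val_Cons [simp]: "word_val M \<iota> \<sigma> (s # w) = symb_val \<iota> \<sigma> s \<otimes>\<^bsub>M\<^esub> word_val M \<iota> \<sigma> w"
  by (simp_all add: word_val_def)

text \<open>
  An assignment is given by the tuple \<open>m\<close>, extended by a list \<open>l\<close> of witnesses and by \<open>\<one>\<close> on
  the variables that do not matter.
\<close>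

lemma e_definableI:
  fixes M :: "'u rel_monoid"
  assumes "monoid M" "S \<subseteq> tuples k (carrier M)" "system_over M (carrier M) \<Sigma>"
    and complete: "\<And>m. m \<in> S \<Longrightarrow> \<exists>l. set l \<subseteq> carrier M \<and>
      (\<forall>e\<in>set \<Sigma>. equation_holds M (\<lambda>c. c) (\<lambda>i. if i < length (m @ l) then (m @ l) ! i else \<one>\<^bsub>M\<^esub>) e)"
    and sound: "\<And>\<sigma>. range \<sigma> \<subseteq> carrier M \<Longrightarrow> \<forall>e\<in>set \<Sigma>. equation_holds M (\<lambda>c. c) \<sigma> e \<Longrightarrow> map \<sigma> [0..<k] \<in> S"
  shows "e_definable M k S"
  unfolding e_definable_def
proof (intro conjI exI[of _ \<Sigma>] ballI iffI)
  fix m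
  assume m: "m \<in> tuples k (carrier M)" and mS: "m \<in> S"
  obtain l where l: "set l \<subseteq> carrier M"
    "\<forall>e\<in>set \<Sigma>. equation_holds M (\<lambda>c. c) (\<lambda>i. if i < length (m @ l) then (m @ l) ! i else \<one>\<^bsub>M\<^esub>) e"
    using complete[OF mS] by (elim exE conjE)
  define \<sigma> where "\<sigma> = (\<lambda>i. if i < length (m @ l) then (m @ l) ! i else \<one>\<^bsub>M\<^esub>)"
  have "\<forall>i<k. \<sigma> i = m ! i"
    using m by (simp add: tuples_def nth_append \<sigma>_def)
  moreover have "\<sigma> i \<in> carrier M" for i
  proof -
    have "set (m @ l) \<subseteq> carrier M"
      using m l(1) by (simp add: tuples_def)
    then show ?thesis
      unfolding \<sigma>_def using monoid.one_closed[OF assms(1)] nth_mem[of i "m @ l"] by (metis subsetD)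
  qed
  moreover have "\<forall>e\<in>set \<Sigma>. equation_holds M (\<lambda>c. c) \<sigma> e"
    using l(2) by (simp only: \<sigma>_def)
  ultimately show "\<exists>\<sigma>. (\<forall>i<k. \<sigma> i = m ! i) \<and> solves M (\<lambda>c. c) \<sigma> \<Sigma>"
    unfolding solves_def by (intro exI[of _ \<sigma>]) (simp add: image_subset_iff)
next
  fix m
  assume m: "m \<in> tuples k (carrier M)" and ex: "\<exists>\<sigma>. (\<forall>i<k. \<sigma> i = m ! i) \<and> solves M (\<lambda>c. c) \<sigma> \<Sigma>"
  from ex obtain \<sigma> where \<sigma>: "\<forall>i<k. \<sigma> i = m ! i" "solves M (\<lambda>c. c) \<sigma> \<Sigma>"
    by (elim exE conjE)
  have "map \<sigma> [0..<k] = m"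
    using \<sigma>(1) m by (intro nth_equalityI) (simp_all add: tuples_def)
  then show "m \<in> S"
    using sound[of \<sigma>] \<sigma>(2) unfolding solves_def by simp
qed (fact assms)+

definition commutes_eq :: "'c \<Rightarrow> nat \<Rightarrow> 'c equation" where
  "commutes_eq c i = Eq [Var i, Coef c] [Coef c, Var i]"

text \<open>
  Provided that only powers of \<open>c\<close> commute with \<open>c\<close>, this says that variable \<open>i\<close> is a right inverse
  of a power of \<open>c\<close>, which is the value of variable \<open>j\<close>.
\<close>

definition length_system :: "'c \<Rightarrow> nat \<Rightarrow> nat \<Rightarrow> 'c system" where
  "length_system c i j = [commutes_eq c j, Eq [Var j, Var i] []]"

text \<open>
  Variable \<open>i\<close> is to be the power of \<open>c\<close> with right inverse \<open>u\<close>; variable \<open>j\<close> is to be the further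
  power by which it has to be multiplied to get one with right inverse \<open>v\<close>.
\<close>

definition length_le_system :: "'c \<Rightarrow> nat \<Rightarrow> nat \<Rightarrow> 'c symb list \<Rightarrow> 'c symb list \<Rightarrow> 'c system" where
  "length_le_system c i j u v =
    [commutes_eq c i, Eq (Var i # u) [], commutes_eq c j, Eq (Var j # Var i # v) []]"

text \<open>
  Interpretability asks for definability of relations on tuples of representatives; if each element of
  \<open>L\<close> is represented by the single element \<open>g w\<close>, these relations are images of relations on \<open>L\<close>.
\<close>

lemma Collect_append_image2:
  assumes "\<And>w. w \<in> L \<Longrightarrow> \<phi> [g w] = w"
  shows "{x @ y | x y. x \<in> (\<lambda>w. [g w]) ` L \<and> y \<in> (\<lambda>w. [g w]) ` L \<and> P (\<phi> x) (\<phi> y)}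
    = map g ` {[u, v] | u v. u \<in> L \<and> v \<in> L \<and> P u v}"
    (is "?A = ?B")
proof -
  have "?A = {[g u, g v] | u v. u \<in> L \<and> v \<in> L \<and> P u v}" (is "_ = ?C")
  proof (intro subset_antisym subsetI)
    show "m \<in> ?C" if "m \<in> ?A" for m
      using that by (clarsimp simp: assms) blast
    show "m \<in> ?A" if mC: "m \<in> ?C" for m
    proof -
      from mC obtain u v where *: "m = [g u] @ [g v]" "u \<in> L" "v \<in> L" "P u v"
        by auto
      then have "P (\<phi> [g u]) (\<phi> [g v])"
        using assms by simp
      with * show ?thesis
        by blast
    qed
  qed
  also have "?C = ?B"
    by force
  finally show ?thesis .
qed

lemma Collect_append_image3:
  assumes "\<And>w. w \<in> L \<Longrightarrow> \<phi> [g w] = w"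
  shows "{x @ y @ z | x y z. x \<in> (\<lambda>w. [g w]) ` L \<and> y \<in> (\<lambda>w. [g w]) ` L \<and> z \<in> (\<lambda>w. [g w]) ` L \<and>
      P (\<phi> x) (\<phi> y) (\<phi> z)}
    = map g ` {[u, v, w] | u v w. u \<in> L \<and> v \<in> L \<and> w \<in> L \<and> P u v w}"
    (is "?A = ?B")
proof -
  have "?A = {[g u, g v, g w] | u v w. u \<in> L \<and> v \<in> L \<and> w \<in> L \<and> P u v w}" (is "_ = ?C")
  proof (intro subset_antisym subsetI)
    show "m \<in> ?C" if "m \<in> ?A" for m
      using that by (clarsimp simp: assms) blast
    show "m \<in> ?A" if mC: "m \<in> ?C" for m
    proof -
      from mC obtain u v w where *: "m = [g u] @ [g v] @ [g w]" "u \<in> L" "v \<in> L" "w \<in> L" "P u v w"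
        by auto
      then have "P (\<phi> [g u]) (\<phi> [g v]) (\<phi> [g w])"
        using assms by simp
      with * show ?thesis
        by blast
    qed
  qed
  also have "?C = ?B"
    by force
  finally show ?thesis .
qed

text \<open>
  A free monoid of rank \<open>n\<close> is embedded in \<open>M\<close> as the set of right inverses of powers of \<open>\<alpha>\<close>, in such a
  way that the exponent is the length. Everything about interpretation and reducibility follows from
  this situation, whatever the length function.
\<close>

locale length_as_right_inverse = monoid M for M :: "'u rel_monoid" (structure) +
  fixes \<alpha> :: 'u and n :: nat and embed :: "nat list \<Rightarrow> 'u" and len :: "nat list \<Rightarrow> nat"
  assumes \<alpha>_closed: "\<alpha> \<in> carrier M"
    and centralizer: "\<And>x. x \<in> carrier M \<Longrightarrow> x \<otimes> \<alpha> = \<alpha> \<otimes> x \<Longrightarrow> \<exists>k::nat. x = \<alpha> [^] k"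
    and pow_inj: "\<And>i j :: nat. \<alpha> [^] i = \<alpha> [^] j \<Longrightarrow> i = j"
    and embed_closed: "\<And>w. w \<in> lists {..<n} \<Longrightarrow> embed w \<in> carrier M"
    and embed_Nil: "embed [] = \<one>"
    and embed_append: "\<And>u v. u \<in> lists {..<n} \<Longrightarrow> v \<in> lists {..<n} \<Longrightarrow> embed (u @ v) = embed u \<otimes> embed v"
    and embed_inj: "inj_on embed (lists {..<n})"
    and pow_right_inverse: "\<And>y k. y \<in> carrier M \<Longrightarrow>
      \<alpha> [^] (k::nat) \<otimes> y = \<one> \<longleftrightarrow> (\<exists>w\<in>lists {..<n}. y = embed w \<and> k = len w)"
begin

abbreviation D :: "nat list rel_monoid" where
  "D \<equiv> free_monoid_with_length n len"

lemma pow_\<alpha>_closed: "\<alpha> [^] (k::nat) \<in> carrier M"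
  using \<alpha>_closed by simp

lemma pow_commutes: "\<alpha> [^] (k::nat) \<otimes> \<alpha> = \<alpha> \<otimes> \<alpha> [^] k"
  using nat_pow_Suc nat_pow_Suc2[OF \<alpha>_closed] by metis

lemma pow_mult_embed:
  assumes "w \<in> lists {..<n}"
  shows "\<alpha> [^] (k::nat) \<otimes> embed w = \<one> \<longleftrightarrow> k = len w"
  unfolding pow_right_inverse[OF embed_closed[OF assms]] using inj_onD[OF embed_inj] assms by metis

lemma commutes_eq_holds:
  assumes "\<iota> c = \<alpha>" "\<sigma> i \<in> carrier M"
  shows "equation_holds M \<iota> \<sigma> (commutes_eq c i) \<longleftrightarrow> (\<exists>k::nat. \<sigma> i = \<alpha> [^] k)"
proof -
  have "equation_holds M \<iota> \<sigma> (commutes_eq c i) \<longleftrightarrow> \<sigma> i \<otimes> \<alpha> = \<alpha> \<otimes> \<sigma> i"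
    using assms \<alpha>_closed by (simp add: commutes_eq_def)
  also have "\<dots> \<longleftrightarrow> (\<exists>k::nat. \<sigma> i = \<alpha> [^] k)"
    using centralizer[OF assms(2)] pow_commutes by metis
  finally show ?thesis .
qed

lemma length_system_holds:
  assumes "\<iota> c = \<alpha>" "\<sigma> i \<in> carrier M" "\<sigma> j \<in> carrier M"
  shows "(\<forall>e\<in>set (length_system c i j). equation_holds M \<iota> \<sigma> e) \<longleftrightarrow>
    (\<exists>w\<in>lists {..<n}. \<sigma> i = embed w \<and> \<sigma> j = \<alpha> [^] len w)"
proof -
  have "(\<forall>e\<in>set (length_system c i j). equation_holds M \<iota> \<sigma> e) \<longleftrightarrow>
      (\<exists>k::nat. \<sigma> j = \<alpha> [^] k) \<and> \<sigma> j \<otimes> \<sigma> i = \<one>"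
    using assms by (simp add: length_system_def commutes_eq_holds)
  also have "\<dots> \<longleftrightarrow> (\<exists>w\<in>lists {..<n}. \<sigma> i = embed w \<and> \<sigma> j = \<alpha> [^] len w)"
    using pow_right_inverse[OF assms(2)] by metis
  finally show ?thesis .
qed

text \<open>
  As \<open>u\<close> and \<open>v\<close> determine the exponents \<open>len p\<close> and \<open>len q\<close>, the second power exists iff the
  difference of the exponents is not negative.
\<close>

lemma length_le_system_holds:
  assumes "\<iota> c = \<alpha>" "\<sigma> i \<in> carrier M" "\<sigma> j \<in> carrier M" "p \<in> lists {..<n}" "q \<in> lists {..<n}"
    and "word_val M \<iota> \<sigma> u = embed p" "word_val M \<iota> \<sigma> v = embed q"
  shows "(\<forall>e\<in>set (length_le_system c i j u v). equation_holds M \<iota> \<sigma> e) \<longleftrightarrow>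
    len p \<le> len q \<and> \<sigma> i = \<alpha> [^] len p \<and> \<sigma> j = \<alpha> [^] (len q - len p)"
    (is "?L \<longleftrightarrow> ?R")
proof -
  have *: "\<alpha> [^] k \<otimes> (\<alpha> [^] m \<otimes> embed q) = \<one> \<longleftrightarrow> k + m = len q" for k m :: nat
    using pow_mult_embed[OF assms(5), of "k + m"] \<alpha>_closed embed_closed[OF assms(5)]
    by (simp add: nat_pow_mult[symmetric] m_assoc)
  have "?L \<longleftrightarrow> (\<exists>m::nat. \<sigma> i = \<alpha> [^] m) \<and> \<sigma> i \<otimes> embed p = \<one> \<and>
      (\<exists>k::nat. \<sigma> j = \<alpha> [^] k) \<and> \<sigma> j \<otimes> (\<sigma> i \<otimes> embed q) = \<one>"
    using assms by (simp add: length_le_system_def commutes_eq_holds)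
  also have "\<dots> \<longleftrightarrow> (\<exists>m k. \<sigma> i = \<alpha> [^] m \<and> \<sigma> j = \<alpha> [^] k \<and> m = len p \<and> k + m = len q)"
    using * pow_mult_embed[OF assms(4)] by metis
  also have "\<dots> \<longleftrightarrow> ?R"
    by (metis add_diff_cancel_right' le_add2 le_add_diff_inverse2)
  finally show ?thesis .
qed

lemma free_monoid_simps [simp]:
  "carrier D = lists {..<n}" "\<one>\<^bsub>D\<^esub> = []" "u \<otimes>\<^bsub>D\<^esub> v = u @ v"
  "rels D = [{(u, v). u \<in> lists {..<n} \<and> v \<in> lists {..<n} \<and> len u \<le> len v}]"
  by (simp_all add: free_monoid_with_length_def)

text \<open>
  To define a set of tuples of words, a system \<open>\<Sigma>\<close> that is correct on tuples from the embedded free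
  monoid is enough: membership of each component in the free monoid is ensured by a
  \<open>length_system\<close>, whose witness variables have the numbers from \<open>k\<close> to \<open>2 * k - 1\<close>.
\<close>

lemma definable_image:
  fixes W :: "nat list list set"
  assumes "W \<subseteq> tuples k (lists {..<n})" "system_over M (carrier M) \<Sigma>"
    and complete: "\<And>ws. ws \<in> W \<Longrightarrow> \<exists>l. set l \<subseteq> carrier M \<and> (\<forall>e\<in>set \<Sigma>. equation_holds M (\<lambda>c. c)
      (\<lambda>i. if i < length (map embed ws @ map (\<lambda>w. \<alpha> [^] len w) ws @ l)
           then (map embed ws @ map (\<lambda>w. \<alpha> [^] len w) ws @ l) ! i else \<one>) e)"
    and sound: "\<And>ws \<sigma>. ws \<in> tuples k (lists {..<n}) \<Longrightarrow> range \<sigma> \<subseteq> carrier M \<Longrightarrow>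
      (\<And>i. i < k \<Longrightarrow> \<sigma> i = embed (ws ! i)) \<Longrightarrow> \<forall>e\<in>set \<Sigma>. equation_holds M (\<lambda>c. c) \<sigma> e \<Longrightarrow> ws \<in> W"
  shows "e_definable M k (map embed ` W)"
proof (rule e_definableI[OF monoid_axioms])
  let ?\<Sigma> = "concat (map (\<lambda>i. length_system \<alpha> i (k + i)) [0..<k]) @ \<Sigma>"
  show "map embed ` W \<subseteq> tuples k (carrier M)"
  proof (rule image_subsetI)
    fix ws
    assume "ws \<in> W"
    then have ws: "length ws = k" "set ws \<subseteq> lists {..<n}"
      using assms(1) by (auto simp only: tuples_def)
    then show "map embed ws \<in> tuples k (carrier M)"
      using embed_closed unfolding tuples_def mem_Collect_eq set_map length_map by blast
  qed
  show "system_over M (carrier M) ?\<Sigma>"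
    using assms(2) \<alpha>_closed by (auto simp: system_over_def length_system_def commutes_eq_def)
  show "\<exists>l. set l \<subseteq> carrier M \<and> (\<forall>e\<in>set ?\<Sigma>. equation_holds M (\<lambda>c. c)
      (\<lambda>i. if i < length (m @ l) then (m @ l) ! i else \<one>) e)" if mW: "m \<in> map embed ` W" for m
  proof -
    from mW obtain ws where m: "m = map embed ws" and "ws \<in> W"
      by blast
    then have ws: "length ws = k" "set ws \<subseteq> lists {..<n}"
      using assms(1) by (auto simp only: tuples_def)
    obtain l where l: "set l \<subseteq> carrier M" "\<forall>e\<in>set \<Sigma>. equation_holds M (\<lambda>c. c)
      (\<lambda>i. if i < length (map embed ws @ map (\<lambda>w. \<alpha> [^] len w) ws @ l)
           then (map embed ws @ map (\<lambda>w. \<alpha> [^] len w) ws @ l) ! i else \<one>) e"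
      using complete[OF \<open>ws \<in> W\<close>] by (elim exE conjE)
    let ?l = "map (\<lambda>w. \<alpha> [^] len w) ws @ l"
    define \<sigma> where "\<sigma> = (\<lambda>i. if i < length (m @ ?l) then (m @ ?l) ! i else \<one>)"
    have "\<forall>e\<in>set (length_system \<alpha> i (k + i)). equation_holds M (\<lambda>c. c) \<sigma> e" if "i < k" for i
    proof -
      have w: "ws ! i \<in> lists {..<n}"
        using ws that nth_mem by blast
      have s: "\<sigma> i = embed (ws ! i)" "\<sigma> (k + i) = \<alpha> [^] len (ws ! i)"
        using ws(1) that by (simp_all add: \<sigma>_def m nth_append)
      then have "\<sigma> i \<in> carrier M" "\<sigma> (k + i) \<in> carrier M"
        using embed_closed[OF w] pow_\<alpha>_closed by simp_all
      from length_system_holds[of "\<lambda>c. c", OF HOL.refl this] show ?thesis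
        using w s by blast
    qed
    moreover have "\<forall>e\<in>set \<Sigma>. equation_holds M (\<lambda>c. c) \<sigma> e"
      using l(2) by (simp only: \<sigma>_def m)
    ultimately have "\<forall>e\<in>set ?\<Sigma>. equation_holds M (\<lambda>c. c) \<sigma> e"
      by fastforce
    moreover have "set ?l \<subseteq> carrier M"
      using l(1) pow_\<alpha>_closed by (simp add: image_subset_iff)
    ultimately show ?thesis
      unfolding \<sigma>_def by (intro exI[of _ ?l] conjI)
  qed
  show "map \<sigma> [0..<k] \<in> map embed ` W"
    if \<sigma>: "range \<sigma> \<subseteq> carrier M" "\<forall>e\<in>set ?\<Sigma>. equation_holds M (\<lambda>c. c) \<sigma> e" for \<sigma>
  proof -
    have c: "\<sigma> i \<in> carrier M" for i
      using \<sigma>(1) by blast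
    have "\<exists>w\<in>lists {..<n}. \<sigma> i = embed w" if "i < k" for i
    proof -
      have "\<forall>i\<in>{0..<k}. \<forall>e\<in>set (length_system \<alpha> i (k + i)). equation_holds M (\<lambda>c. c) \<sigma> e"
        using \<sigma>(2) by (simp add: ball_Un)
      then have "\<forall>e\<in>set (length_system \<alpha> i (k + i)). equation_holds M (\<lambda>c. c) \<sigma> e"
        using that by simp
      from iffD1[OF length_system_holds[of "\<lambda>c. c" \<alpha> \<sigma>, OF HOL.refl c c] this] show ?thesis
        by (elim bexE conjE) (rule bexI)
    qed
    then obtain f where f: "\<And>i. i < k \<Longrightarrow> f i \<in> lists {..<n} \<and> \<sigma> i = embed (f i)"
      by metis
    have "map f [0..<k] \<in> W"
    proof (rule sound[OF _ \<sigma>(1)])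
      show "map f [0..<k] \<in> tuples k (lists {..<n})"
        using f by (simp add: tuples_def image_subset_iff)
      show "\<forall>e\<in>set \<Sigma>. equation_holds M (\<lambda>c. c) \<sigma> e"
        using \<sigma>(2) by simp
    qed (simp add: f)
    moreover have "map \<sigma> [0..<k] = map embed (map f [0..<k])"
      using f by simp
    ultimately show ?thesis
      by (simp only: image_eqI)
  qed
qed

lemma definable_length_relation:
  "e_definable M 2 (map embed ` {[u, v] | u v. u \<in> lists {..<n} \<and> v \<in> lists {..<n} \<and> len u \<le> len v})"
    (is "e_definable M 2 (map embed ` ?W)")
proof (rule definable_image)
  let ?\<Sigma> = "length_le_system \<alpha> 4 5 [Var 0] [Var 1]"
  show "?W \<subseteq> tuples 2 (lists {..<n})"
    unfolding tuples_def by force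
  show "system_over M (carrier M) ?\<Sigma>"
    using \<alpha>_closed by (simp add: system_over_def length_le_system_def commutes_eq_def)
  show "\<exists>l. set l \<subseteq> carrier M \<and> (\<forall>e\<in>set ?\<Sigma>. equation_holds M (\<lambda>c. c)
      (\<lambda>i. if i < length (map embed ws @ map (\<lambda>w. \<alpha> [^] len w) ws @ l)
           then (map embed ws @ map (\<lambda>w. \<alpha> [^] len w) ws @ l) ! i else \<one>) e)"
    if W: "ws \<in> ?W" for ws
  proof -
    from W obtain u v where ws: "ws = [u, v]" and uv: "u \<in> lists {..<n}" "v \<in> lists {..<n}" "len u \<le> len v"
      by blast
    \<comment> \<open>variables 0 and 1 hold the two elements, 2 and 3 their own witnesses, 4 and 5 those of the comparison\<close>
    let ?l = "[\<alpha> [^] len u, \<alpha> [^] (len v - len u)]"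
    define \<sigma> where "\<sigma> = (\<lambda>i. if i < length (map embed ws @ map (\<lambda>w. \<alpha> [^] len w) ws @ ?l)
      then (map embed ws @ map (\<lambda>w. \<alpha> [^] len w) ws @ ?l) ! i else \<one>)"
    have s: "\<sigma> 0 = embed u" "\<sigma> 1 = embed v" "\<sigma> 4 = \<alpha> [^] len u" "\<sigma> 5 = \<alpha> [^] (len v - len u)"
      by (simp_all add: \<sigma>_def ws)
    have "\<forall>e\<in>set ?\<Sigma>. equation_holds M (\<lambda>c. c) \<sigma> e"
      using uv s embed_closed pow_\<alpha>_closed
        length_le_system_holds[of "\<lambda>c. c" \<alpha> \<sigma> 4 5 u v "[Var 0]" "[Var 1]"] by simp
    then show ?thesis
      using pow_\<alpha>_closed unfolding \<sigma>_def by (intro exI[of _ ?l] conjI) simp_all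
  qed
  show "ws \<in> ?W"
    if ws: "ws \<in> tuples 2 (lists {..<n})" and \<sigma>: "range \<sigma> \<subseteq> carrier M" "\<And>i. i < 2 \<Longrightarrow> \<sigma> i = embed (ws ! i)"
      "\<forall>e\<in>set ?\<Sigma>. equation_holds M (\<lambda>c. c) \<sigma> e" for ws \<sigma>
  proof -
    obtain u v where uv: "ws = [u, v]" "u \<in> lists {..<n}" "v \<in> lists {..<n}"
      using ws by (auto simp: tuples_def numeral_2_eq_2 length_Suc_conv)
    have c: "\<sigma> i \<in> carrier M" for i
      using \<sigma>(1) by blast
    have "\<sigma> 0 = embed u" "\<sigma> 1 = embed v"
      using \<sigma>(2)[of 0] \<sigma>(2)[of 1] uv(1) by simp_all
    then have "len u \<le> len v"
      using length_le_system_holds[of "\<lambda>c. c" \<alpha> \<sigma> 4 5 u v "[Var 0]" "[Var 1]"] \<sigma>(3) c uv embed_closed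
      by simp
    then show ?thesis
      using uv by simp
  qed
qed

lemma definable_image_iff:
  fixes W :: "nat list list set"
  assumes W: "W \<subseteq> tuples k (lists {..<n})" and "system_over M (carrier M) \<Sigma>"
    and iff: "\<And>ws \<sigma>. ws \<in> tuples k (lists {..<n}) \<Longrightarrow> (\<And>i. i < k \<Longrightarrow> \<sigma> i = embed (ws ! i)) \<Longrightarrow>
      (\<forall>e\<in>set \<Sigma>. equation_holds M (\<lambda>c. c) \<sigma> e) \<longleftrightarrow> ws \<in> W"
  shows "e_definable M k (map embed ` W)"
proof (rule definable_image[OF assms(1,2)])
  fix ws
  assume "ws \<in> W"
  let ?m = "map embed ws @ map (\<lambda>w. \<alpha> [^] len w) ws @ []"
  have ws: "ws \<in> tuples k (lists {..<n})"
    using W \<open>ws \<in> W\<close> by (rule subsetD)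
  then have "(if i < length ?m then ?m ! i else \<one>) = embed (ws ! i)" if "i < k" for i
    using that by (simp add: tuples_def nth_append)
  from iff[OF ws this] \<open>ws \<in> W\<close>
  show "\<exists>l. set l \<subseteq> carrier M \<and> (\<forall>e\<in>set \<Sigma>. equation_holds M (\<lambda>c. c)
      (\<lambda>i. if i < length (map embed ws @ map (\<lambda>w. \<alpha> [^] len w) ws @ l)
           then (map embed ws @ map (\<lambda>w. \<alpha> [^] len w) ws @ l) ! i else \<one>) e)"
    by (intro exI[of _ "[]"]) simp
qed (use iff in blast)

lemma definable_domain: "e_definable M 1 (map embed ` tuples 1 (lists {..<n}))"
  by (rule definable_image_iff[of _ _ "[]"]) (simp_all add: system_over_def)

lemma definable_equality: "e_definable M 2 (map embed ` {[u, v] | u v. u \<in> lists {..<n} \<and> v \<in> lists {..<n} \<and> u = v})"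
proof (rule definable_image_iff[of _ _ "[Eq [Var 0] [Var 1]]"])
  fix ws \<sigma>
  assume ws: "ws \<in> tuples 2 (lists {..<n})" and \<sigma>: "\<And>i. i < 2 \<Longrightarrow> \<sigma> i = embed (ws ! i)"
  obtain u v where uv: "ws = [u, v]" "u \<in> lists {..<n}" "v \<in> lists {..<n}"
    using ws by (auto simp: tuples_def numeral_2_eq_2 length_Suc_conv)
  then show "(\<forall>e\<in>set [Eq [Var 0] [Var 1]]. equation_holds M (\<lambda>c. c) \<sigma> e) \<longleftrightarrow>
      ws \<in> {[u, v] | u v. u \<in> lists {..<n} \<and> v \<in> lists {..<n} \<and> u = v}"
    using \<sigma>[of 0] \<sigma>[of 1] embed_closed inj_on_eq_iff[OF embed_inj, of u v] by auto
qed (auto simp: system_over_def tuples_def)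

lemma definable_one: "e_definable M 1 (map embed ` {[[]]})"
proof (rule definable_image_iff[of _ _ "[Eq [Var 0] []]"])
  fix ws \<sigma>
  assume ws: "ws \<in> tuples 1 (lists {..<n})" and \<sigma>: "\<And>i. i < 1 \<Longrightarrow> \<sigma> i = embed (ws ! i)"
  obtain u where u: "ws = [u]" "u \<in> lists {..<n}"
    using ws by (auto simp: tuples_def length_Suc_conv)
  then show "(\<forall>e\<in>set [Eq [Var 0] []]. equation_holds M (\<lambda>c. c) \<sigma> e) \<longleftrightarrow> ws \<in> {[[]]}"
    using \<sigma>[of 0] embed_closed inj_on_eq_iff[OF embed_inj, of u "[]"] embed_Nil by simp
qed (auto simp: system_over_def tuples_def)

lemma definable_product:
  "e_definable M 3 (map embed ` {[u, v, w] | u v w. u \<in> lists {..<n} \<and> v \<in> lists {..<n} \<and> w \<in> lists {..<n} \<and> u @ v = w})"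
proof (rule definable_image_iff[of _ _ "[Eq [Var 0, Var 1] [Var 2]]"])
  fix ws \<sigma>
  assume ws: "ws \<in> tuples 3 (lists {..<n})" and \<sigma>: "\<And>i. i < 3 \<Longrightarrow> \<sigma> i = embed (ws ! i)"
  obtain u v w where uv: "ws = [u, v, w]" "u \<in> lists {..<n}" "v \<in> lists {..<n}" "w \<in> lists {..<n}"
    using ws by (auto simp: tuples_def numeral_3_eq_3 length_Suc_conv)
  have "(\<forall>e\<in>set [Eq [Var 0, Var 1] [Var 2]]. equation_holds M (\<lambda>c. c) \<sigma> e) \<longleftrightarrow> embed u \<otimes> embed v = embed w"
    using \<sigma>[of 0] \<sigma>[of 1] \<sigma>[of 2] embed_closed uv by simp
  also have "\<dots> \<longleftrightarrow> u @ v = w"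
    using inj_on_eq_iff[OF embed_inj, of "u @ v" w] embed_append[OF uv(2,3)] uv by simp
  also have "\<dots> \<longleftrightarrow> ws \<in> {[u, v, w] | u v w. u \<in> lists {..<n} \<and> v \<in> lists {..<n} \<and> w \<in> lists {..<n} \<and> u @ v = w}"
    unfolding uv(1) using uv(2,3,4) by blast
  finally show "(\<forall>e\<in>set [Eq [Var 0, Var 1] [Var 2]]. equation_holds M (\<lambda>c. c) \<sigma> e) \<longleftrightarrow>
      ws \<in> {[u, v, w] | u v w. u \<in> lists {..<n} \<and> v \<in> lists {..<n} \<and> w \<in> lists {..<n} \<and> u @ v = w}" .
qed (force simp: system_over_def tuples_def)+

theorem e_interpretable_in_M: "e_interpretable D M"
proof -
  let ?S = "map embed ` tuples 1 (lists {..<n})"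
  let ?\<phi> = "\<lambda>x. the_inv_into (lists {..<n}) embed (hd x)"
  let ?L = "{(u, v). u \<in> lists {..<n} \<and> v \<in> lists {..<n} \<and> len u \<le> len v}"
  have S: "?S = (\<lambda>w. [embed w]) ` lists {..<n}"
  proof -
    have "tuples 1 L = (\<lambda>w. [w]) ` L" for L :: "nat list set"
      by (auto simp: tuples_def length_Suc_conv)
    then show ?thesis
      by (simp only: image_image list.map)
  qed
  have \<phi>: "?\<phi> [embed w] = w" if "w \<in> lists {..<n}" for w
    using the_inv_into_f_f[OF embed_inj that] by simp
  have "bij_betw ?\<phi> ?S (lists {..<n})"
    unfolding S bij_betw_def inj_on_def image_image by (simp add: the_inv_into_f_f[OF embed_inj])
  moreover have "{x @ y | x y. x \<in> ?S \<and> y \<in> ?S \<and> ?\<phi> x = ?\<phi> y}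
      = map embed ` {[u, v] | u v. u \<in> lists {..<n} \<and> v \<in> lists {..<n} \<and> u = v}"
    unfolding S by (rule Collect_append_image2) (rule \<phi>)
  moreover have "{x \<in> ?S. ?\<phi> x = []} = map embed ` {[[]]}"
  proof (intro subset_antisym subsetI)
    show "m \<in> map embed ` {[[]]}" if m: "m \<in> {x \<in> ?S. ?\<phi> x = []}" for m
    proof -
      obtain w where "w \<in> lists {..<n}" "m = [embed w]" "?\<phi> m = []"
        using m unfolding S by blast
      then show ?thesis
        using \<phi>[of w] by simp
    qed
    have "[[]] \<in> tuples 1 (lists {..<n})" "?\<phi> [embed []] = []"
      using \<phi>[of "[]"] by (simp_all add: tuples_def)
    then show "m \<in> {x \<in> ?S. ?\<phi> x = []}" if "m \<in> map embed ` {[[]]}" for m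
      using that by (simp add: rev_image_eqI)
  qed
  moreover have "{x @ y @ z | x y z. x \<in> ?S \<and> y \<in> ?S \<and> z \<in> ?S \<and> ?\<phi> x @ ?\<phi> y = ?\<phi> z}
      = map embed ` {[u, v, w] | u v w. u \<in> lists {..<n} \<and> v \<in> lists {..<n} \<and> w \<in> lists {..<n} \<and> u @ v = w}"
    unfolding S by (rule Collect_append_image3) (rule \<phi>)
  moreover have "{x @ y | x y. x \<in> ?S \<and> y \<in> ?S \<and> (?\<phi> x, ?\<phi> y) \<in> ?L}
      = map embed ` {[u, v] | u v. u \<in> lists {..<n} \<and> v \<in> lists {..<n} \<and> (u, v) \<in> ?L}"
    unfolding S by (rule Collect_append_image2) (rule \<phi>)
  moreover have "{[u, v] | u v. u \<in> lists {..<n} \<and> v \<in> lists {..<n} \<and> (u, v) \<in> ?L}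
      = {[u, v] | u v. u \<in> lists {..<n} \<and> v \<in> lists {..<n} \<and> len u \<le> len v}"
    by (simp cong: conj_cong)
  ultimately show ?thesis
    unfolding e_interpretable_def free_monoid_simps
    using definable_domain definable_equality definable_one definable_product definable_length_relation
    by (intro exI[of _ 1] exI[of _ ?S] exI[of _ ?\<phi>])
      (simp only: mult_1_right list.set ball_simps simp_thms HOL.True_implies_equals)
qed

end

section \<open>Translating systems of equations\<close>

text \<open>
  The translation of systems of equations over the free monoid. The variables of the target are split
  by their residue modulo 4: \<open>4 i\<close> is the image of variable \<open>i\<close>, \<open>4 i + 1\<close> is the power of \<open>\<alpha>\<close> that
  witnesses that it is in the free monoid, and \<open>4 m + 2\<close>, \<open>4 m + 3\<close> are the witnesses for the length
  constraint with code \<open>m\<close>. So distinct constraints use distinct fresh variables and no counter is needed.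
  A coefficient is translated letter by letter with \<open>\<omega>\<close>.
\<close>

primrec translate_symb :: "('l \<Rightarrow> 'c) \<Rightarrow> 'l list symb \<Rightarrow> 'c symb list" where
  "translate_symb \<omega> (Var i) = [Var (4 * i)]"
| "translate_symb \<omega> (Coef w) = map (\<lambda>k. Coef (\<omega> k)) w"

definition translate_word :: "('l \<Rightarrow> 'c) \<Rightarrow> 'l list symb list \<Rightarrow> 'c symb list" where
  "translate_word \<omega> w = concat (map (translate_symb \<omega>) w)"

text \<open>
  A constraint with a relation symbol other than the only one of the source becomes
  \<^term>\<open>Rel 0 [] []\<close>, which is not an equation over a structure without relations. So systems that are not
  well-formed are mapped to such systems.
\<close>

primrec translate_equation :: "('l \<Rightarrow> 'c) \<Rightarrow> 'c \<Rightarrow> nat \<Rightarrow> 'l list equation \<Rightarrow> 'c system" where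
  "translate_equation \<omega> c m (Eq u v) = [Eq (translate_word \<omega> u) (translate_word \<omega> v)]"
| "translate_equation \<omega> c m (Rel i u v) =
    (if i = 0 then length_le_system c (4 * m + 2) (4 * m + 3) (translate_word \<omega> u) (translate_word \<omega> v)
     else [Rel 0 [] []])"

definition translate_system :: "('l \<Rightarrow> nat) \<Rightarrow> ('l \<Rightarrow> 'c) \<Rightarrow> 'c \<Rightarrow> nat \<Rightarrow> 'l list system \<Rightarrow> 'c system" where
  "translate_system num \<omega> c N \<Sigma> =
    concat (map (\<lambda>e. translate_equation \<omega> c (equation_code num e) e) \<Sigma>) @
    concat (map (\<lambda>i. length_system c (4 * i) (4 * i + 1)) (rev [0..<N]))"

primrec equation_vars :: "'c equation \<Rightarrow> nat set" where
  "equation_vars (Eq u v) = {i. Var i \<in> set (u @ v)}"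
| "equation_vars (Rel k u v) = {i. Var i \<in> set (u @ v)}"

context length_as_right_inverse
begin

lemma word_val_coefficients:
  assumes "\<And>k. k < n \<Longrightarrow> \<iota> (\<omega> k) = embed [k]" "w \<in> lists {..<n}" "word_val M \<iota> \<tau> rest \<in> carrier M"
  shows "word_val M \<iota> \<tau> (map (\<lambda>k. Coef (\<omega> k)) w @ rest) = embed w \<otimes> word_val M \<iota> \<tau> rest"
  using assms(2)
proof (induction w rule: list.induct)
  case Nil
  then show ?case
    using assms(3) embed_Nil by simp
next
  case (Cons k w)
  have k: "k < n" "w \<in> lists {..<n}" "[k] \<in> lists {..<n}"
    using Cons.prems by simp_all
  have "embed (k # w) = embed [k] \<otimes> embed w"
    using embed_append[OF k(3,2)] by simp
  then show ?case
    using Cons.IH k assms(1)[OF k(1)] embed_closed[OF k(3)] embed_closed[OF k(2)] assms(3)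
    by (simp add: m_assoc)
qed

lemma word_val_translate_word:
  assumes "\<And>k. k < n \<Longrightarrow> \<iota> (\<omega> k) = embed [k]" "(\<Union>s\<in>set w. set_symb s) \<subseteq> lists {..<n}"
    "\<And>i. Var i \<in> set w \<Longrightarrow> \<sigma> i \<in> lists {..<n} \<and> \<tau> (4 * i) = embed (\<sigma> i)"
  shows "word_val D (\<lambda>w. w) \<sigma> w \<in> lists {..<n} \<and>
    word_val M \<iota> \<tau> (translate_word \<omega> w) = embed (word_val D (\<lambda>w. w) \<sigma> w)"
  using assms(2,3)
proof (induction w)
  case Nil
  then show ?case
    using embed_Nil by (simp add: translate_word_def)
next
  case (Cons s w)
  have IH: "word_val D (\<lambda>w. w) \<sigma> w \<in> lists {..<n}"
    "word_val M \<iota> \<tau> (translate_word \<omega> w) = embed (word_val D (\<lambda>w. w) \<sigma> w)"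
    using Cons.IH Cons.prems by simp_all
  show ?case
  proof (cases s)
    case (Var i)
    then show ?thesis
      using IH Cons.prems(2)[of i] embed_append by (simp add: translate_word_def)
  next
    case (Coef v)
    then have "v \<in> lists {..<n}"
      using Cons.prems(1) by simp
    then show ?thesis
      using Coef IH word_val_coefficients[of \<iota> \<omega> v \<tau> "translate_word \<omega> w", OF assms(1)]
        embed_closed[OF IH(1)] embed_append[of v] by (simp add: translate_word_def)
  qed
qed

lemma translate_equation_holds:
  assumes \<omega>: "\<And>k. k < n \<Longrightarrow> \<iota> (\<omega> k) = embed [k]" and c: "\<iota> c = \<alpha>"
    and over: "equation_over D (lists {..<n}) e"
    and vars: "\<And>i. i \<in> equation_vars e \<Longrightarrow> \<sigma> i \<in> lists {..<n} \<and> \<tau> (4 * i) = embed (\<sigma> i)"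
    and \<tau>: "range \<tau> \<subseteq> carrier M"
  shows "(\<forall>e'\<in>set (translate_equation \<omega> c m e). equation_holds M \<iota> \<tau> e') \<longleftrightarrow>
    equation_holds D (\<lambda>w. w) \<sigma> e \<and> (\<forall>u v. e = Rel 0 u v \<longrightarrow>
      \<tau> (4 * m + 2) = \<alpha> [^] len (word_val D (\<lambda>w. w) \<sigma> u) \<and>
      \<tau> (4 * m + 3) = \<alpha> [^] (len (word_val D (\<lambda>w. w) \<sigma> v) - len (word_val D (\<lambda>w. w) \<sigma> u)))"
proof (cases e)
  case (Eq u v)
  have u: "word_val D (\<lambda>w. w) \<sigma> u \<in> lists {..<n} \<and>
      word_val M \<iota> \<tau> (translate_word \<omega> u) = embed (word_val D (\<lambda>w. w) \<sigma> u)"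
    and v: "word_val D (\<lambda>w. w) \<sigma> v \<in> lists {..<n} \<and>
      word_val M \<iota> \<tau> (translate_word \<omega> v) = embed (word_val D (\<lambda>w. w) \<sigma> v)"
    using over vars Eq by (intro word_val_translate_word \<omega>; simp)+
  then show ?thesis
    using Eq inj_on_eq_iff[OF embed_inj] by simp
next
  case (Rel i u v)
  then have i: "i = 0"
    using over by simp
  have u: "word_val D (\<lambda>w. w) \<sigma> u \<in> lists {..<n} \<and>
      word_val M \<iota> \<tau> (translate_word \<omega> u) = embed (word_val D (\<lambda>w. w) \<sigma> u)"
    and v: "word_val D (\<lambda>w. w) \<sigma> v \<in> lists {..<n} \<and>
      word_val M \<iota> \<tau> (translate_word \<omega> v) = embed (word_val D (\<lambda>w. w) \<sigma> v)"
    using over vars Rel by (intro word_val_translate_word \<omega>; simp)+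
  have "\<tau> j \<in> carrier M" for j
    using \<tau> by blast
  with length_le_system_holds[of \<iota> c \<tau> "4 * m + 2" "4 * m + 3"
      "word_val D (\<lambda>w. w) \<sigma> u" "word_val D (\<lambda>w. w) \<sigma> v" "translate_word \<omega> u" "translate_word \<omega> v"] u v c
  show ?thesis
    using Rel i by simp
qed

text \<open>
  Given a solution \<open>\<sigma>\<close> over the free monoid, all witnesses are determined as powers of \<open>\<alpha>\<close>; injectivity
  of the codes lets the witnesses for each length constraint be chosen separately. Conversely, the
  equations for the variables below \<open>N\<close> place a solution over \<open>M\<close> in the embedded free monoid.
\<close>

lemma solvable_translate_system:
  assumes \<omega>: "\<And>k. k < n \<Longrightarrow> \<iota> (\<omega> k) = embed [k]" and c: "\<iota> c = \<alpha>"
    and over: "system_over D (lists {..<n}) \<Sigma>"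
    and vars: "\<And>e. e \<in> set \<Sigma> \<Longrightarrow> equation_vars e \<subseteq> {..<N}"
    and inj: "inj_on (equation_code num) (set \<Sigma>)"
  shows "(\<exists>\<sigma>. solves D (\<lambda>w. w) \<sigma> \<Sigma>) \<longleftrightarrow> (\<exists>\<tau>. solves M \<iota> \<tau> (translate_system num \<omega> c N \<Sigma>))"
proof
  assume "\<exists>\<sigma>. solves D (\<lambda>w. w) \<sigma> \<Sigma>"
  then obtain \<sigma> where \<sigma>: "\<And>i. \<sigma> i \<in> lists {..<n}" "\<And>e. e \<in> set \<Sigma> \<Longrightarrow> equation_holds D (\<lambda>w. w) \<sigma> e"
    by (auto simp only: solves_def free_monoid_simps)
  let ?val = "word_val D (\<lambda>w. w) \<sigma>"
  define lhs where "lhs e = (case e of Eq u v \<Rightarrow> 0 | Rel i u v \<Rightarrow> len (?val u))" for e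
  define rhs where "rhs e = (case e of Eq u v \<Rightarrow> 0 | Rel i u v \<Rightarrow> len (?val v))" for e
  define dec where "dec = inv_into (set \<Sigma>) (equation_code num)"
  define \<tau> where "\<tau> i = (if i mod 4 = 0 then embed (\<sigma> (i div 4)) else \<alpha> [^]
    (if i mod 4 = 1 then len (\<sigma> (i div 4)) else if i mod 4 = 2 then lhs (dec (i div 4))
     else rhs (dec (i div 4)) - lhs (dec (i div 4))))" for i
  have \<tau>_simps: "\<tau> (4 * i) = embed (\<sigma> i)" "\<tau> (4 * i + 1) = \<alpha> [^] len (\<sigma> i)"
    "\<tau> (4 * i + 2) = \<alpha> [^] lhs (dec i)" "\<tau> (4 * i + 3) = \<alpha> [^] (rhs (dec i) - lhs (dec i))" for i
  proof -
    have "(4 * i + 1) mod 4 = 1" "(4 * i + 2) mod 4 = 2" "(4 * i + 3) mod 4 = 3"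
      "(4 * i + 1) div 4 = i" "(4 * i + 2) div 4 = i" "(4 * i + 3) div 4 = i"
      by presburger+
    then show "\<tau> (4 * i) = embed (\<sigma> i)" "\<tau> (4 * i + 1) = \<alpha> [^] len (\<sigma> i)"
      "\<tau> (4 * i + 2) = \<alpha> [^] lhs (dec i)" "\<tau> (4 * i + 3) = \<alpha> [^] (rhs (dec i) - lhs (dec i))"
      unfolding \<tau>_def by simp_all
  qed
  have closed: "\<tau> i \<in> carrier M" for i
    unfolding \<tau>_def using embed_closed[OF \<sigma>(1)] pow_\<alpha>_closed by simp
  then have range: "range \<tau> \<subseteq> carrier M"
    by blast
  have "\<forall>e'\<in>set (translate_equation \<omega> c (equation_code num e) e). equation_holds M \<iota> \<tau> e'"
    if e: "e \<in> set \<Sigma>" for e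
  proof -
    have dec: "dec (equation_code num e) = e"
      unfolding dec_def using inj e by (rule inv_into_f_f)
    have "e = Rel 0 u v \<longrightarrow> \<tau> (4 * equation_code num e + 2) = \<alpha> [^] len (?val u) \<and>
      \<tau> (4 * equation_code num e + 3) = \<alpha> [^] (len (?val v) - len (?val u))" for u v
      unfolding \<tau>_simps dec by (simp add: lhs_def rhs_def)
    moreover have "equation_over D (lists {..<n}) e"
      using over e by (simp add: system_over_def)
    ultimately show ?thesis
      using translate_equation_holds[of \<iota> \<omega> c e \<sigma> \<tau> "equation_code num e", OF \<omega> c _ _ range] \<sigma> e \<tau>_simps(1)
      by blast
  qed
  moreover have "\<forall>e'\<in>set (length_system c (4 * i) (4 * i + 1)). equation_holds M \<iota> \<tau> e'" for i
    unfolding length_system_holds[of \<iota> c \<tau>, OF c closed closed] \<tau>_simps using \<sigma>(1) by blast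
  ultimately have "solves M \<iota> \<tau> (translate_system num \<omega> c N \<Sigma>)"
    using range by (simp add: solves_def translate_system_def ball_Un)
  then show "\<exists>\<tau>. solves M \<iota> \<tau> (translate_system num \<omega> c N \<Sigma>)"
    by blast
next
  assume "\<exists>\<tau>. solves M \<iota> \<tau> (translate_system num \<omega> c N \<Sigma>)"
  then obtain \<tau> where \<tau>: "solves M \<iota> \<tau> (translate_system num \<omega> c N \<Sigma>)"
    by blast
  then have range: "range \<tau> \<subseteq> carrier M"
    and eqs: "\<forall>e\<in>set \<Sigma>. \<forall>e'\<in>set (translate_equation \<omega> c (equation_code num e) e). equation_holds M \<iota> \<tau> e'"
    and sys: "\<forall>i\<in>{0..<N}. \<forall>e'\<in>set (length_system c (4 * i) (4 * i + 1)). equation_holds M \<iota> \<tau> e'"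
    by (simp_all add: solves_def translate_system_def ball_Un)
  have closed: "\<tau> i \<in> carrier M" for i
    using range by blast
  have "\<forall>i. \<exists>w\<in>lists {..<n}. i < N \<longrightarrow> \<tau> (4 * i) = embed w"
  proof
    fix i
    show "\<exists>w\<in>lists {..<n}. i < N \<longrightarrow> \<tau> (4 * i) = embed w"
    proof (cases "i < N")
      case True
      then have "\<forall>e'\<in>set (length_system c (4 * i) (4 * i + 1)). equation_holds M \<iota> \<tau> e'"
        using sys by simp
      then show ?thesis
        unfolding length_system_holds[of \<iota> c \<tau>, OF c closed closed] by blast
    next
      case False
      then show ?thesis
        by (intro bexI[of _ "[]"]) simp_all
    qed
  qed
  then obtain \<sigma> where \<sigma>: "\<And>i. \<sigma> i \<in> lists {..<n}" "\<And>i. i < N \<Longrightarrow> \<tau> (4 * i) = embed (\<sigma> i)"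
    by metis
  have "equation_holds D (\<lambda>w. w) \<sigma> e" if e: "e \<in> set \<Sigma>" for e
  proof -
    have "equation_over D (lists {..<n}) e"
      using over e by (simp add: system_over_def)
    moreover have "\<sigma> i \<in> lists {..<n} \<and> \<tau> (4 * i) = embed (\<sigma> i)" if "i \<in> equation_vars e" for i
      using \<sigma> vars[OF e] that by blast
    ultimately show ?thesis
      using translate_equation_holds[of \<iota> \<omega> c e \<sigma> \<tau> "equation_code num e", OF \<omega> c _ _ range] eqs e by blast
  qed
  then have "solves D (\<lambda>w. w) \<sigma> \<Sigma>"
    using \<sigma>(1) by (simp add: solves_def image_subset_iff)
  then show "\<exists>\<sigma>. solves D (\<lambda>w. w) \<sigma> \<Sigma>"
    by blast
qed

end

section \<open>Functions computable relative to an oracle\<close>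

text \<open>
  Total functions of a fixed number \<open>k\<close> of arguments that are computed by a program with oracle \<open>Q\<close>.
  Arguments are passed as a list, so that closure properties can be stated for functions
  \<open>\<lambda>xs. F (f xs) (g xs)\<close> and applied as introduction rules.
\<close>

definition computable :: "nat set \<Rightarrow> nat \<Rightarrow> (nat list \<Rightarrow> nat) \<Rightarrow> bool" where
  "computable Q k f \<longleftrightarrow> (\<exists>p. \<forall>xs. length xs = k \<longrightarrow> rec_eval Q p xs (f xs))"

lemma computable_cong:
  assumes "computable Q k f" "\<And>xs. length xs = k \<Longrightarrow> f xs = g xs"
  shows "computable Q k g"
  using assms unfolding computable_def by metis

lemma computable_compose:
  assumes "computable Q (length gs) f" "\<And>g. g \<in> set gs \<Longrightarrow> computable Q k g"
  shows "computable Q k (\<lambda>xs. f (map (\<lambda>g. g xs) gs))"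
proof -
  obtain p where p: "\<And>xs. length xs = length gs \<Longrightarrow> rec_eval Q p xs (f xs)"
    using assms(1) unfolding computable_def by blast
  obtain q where q: "\<And>g xs. g \<in> set gs \<Longrightarrow> length xs = k \<Longrightarrow> rec_eval Q (q g) xs (g xs)"
    using assms(2) unfolding computable_def by metis
  have "rec_eval Q (Comp p (map q gs)) xs (f (map (\<lambda>g. g xs) gs))" if "length xs = k" for xs
    using p[of "map (\<lambda>g. g xs) gs"] q that
    by (intro rec_eval.intros(5)[of Q _ _ "map (\<lambda>g. g xs) gs"])
      (auto simp: list_all2_conv_all_nth)
  then show ?thesis
    unfolding computable_def by blast
qed

lemma computable_compose1:
  assumes "computable Q 1 (\<lambda>xs. F (xs ! 0))" "computable Q k f"
  shows "computable Q k (\<lambda>xs. F (f xs))"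
  using computable_compose[of Q "[f]" "\<lambda>xs. F (xs ! 0)" k] assms by simp

lemma computable_compose2:
  assumes "computable Q 2 (\<lambda>xs. F (xs ! 0) (xs ! 1))" "computable Q k f" "computable Q k g"
  shows "computable Q k (\<lambda>xs. F (f xs) (g xs))"
  using computable_compose[of Q "[f, g]" "\<lambda>xs. F (xs ! 0) (xs ! 1)" k] assms
  by (auto simp: numeral_2_eq_2)

lemma computable_compose3:
  assumes "computable Q 3 (\<lambda>xs. F (xs ! 0) (xs ! 1) (xs ! 2))"
    "computable Q k f" "computable Q k g" "computable Q k h"
  shows "computable Q k (\<lambda>xs. F (f xs) (g xs) (h xs))"
  using computable_compose[of Q "[f, g, h]" "\<lambda>xs. F (xs ! 0) (xs ! 1) (xs ! 2)" k] assms
  by (auto simp: numeral_3_eq_3 numeral_2_eq_2)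

named_theorems computable_intros

lemma computable_nth [computable_intros]: "i < k \<Longrightarrow> computable Q k (\<lambda>xs. xs ! i)"
  unfolding computable_def using rec_eval.intros(3) by metis

lemma computable_Suc [computable_intros]:
  assumes "computable Q k f"
  shows "computable Q k (\<lambda>xs. Suc (f xs))"
proof (rule computable_compose1[OF _ assms])
  have "rec_eval Q Succ xs (Suc (xs ! 0))" if "length xs = 1" for xs
    using rec_eval.intros(2) that by (cases xs) auto
  then show "computable Q 1 (\<lambda>xs. Suc (xs ! 0))"
    unfolding computable_def by blast
qed

lemma computable_oracle:
  assumes "computable Q k f"
  shows "computable Q k (\<lambda>xs. of_bool (f xs \<in> Q))"
proof (rule computable_compose1[OF _ assms])
  have "rec_eval Q Oracle xs (of_bool (xs ! 0 \<in> Q))" if "length xs = 1" for xs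
    using rec_eval.intros(4) that by (cases xs) auto
  then show "computable Q 1 (\<lambda>xs. of_bool (xs ! 0 \<in> Q))"
    unfolding computable_def by blast
qed

lemma computable_const [computable_intros]: "computable Q k (\<lambda>_. c)"
proof (induction c)
  case 0
  then show ?case
    unfolding computable_def using rec_eval.intros(1) by blast
next
  case (Suc c)
  then show ?case
    by (rule computable_Suc)
qed

lemma computable_PrimRec:
  assumes "computable Q k f" "computable Q (Suc (Suc k)) g"
  shows "computable Q (Suc k) (\<lambda>xs. rec_nat (f (tl xs)) (\<lambda>i y. g (i # y # tl xs)) (hd xs))"
proof -
  obtain p where p: "\<And>xs. length xs = k \<Longrightarrow> rec_eval Q p xs (f xs)"
    using assms(1) unfolding computable_def by blast
  obtain q where q: "\<And>xs. length xs = Suc (Suc k) \<Longrightarrow> rec_eval Q q xs (g xs)"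
    using assms(2) unfolding computable_def by blast
  have "rec_eval Q (PrimRec p q) (n # xs) (rec_nat (f xs) (\<lambda>i y. g (i # y # xs)) n)"
    if "length xs = k" for n xs
  proof (induction n)
    case (Suc n)
    then show ?case
      using rec_eval.intros(7)[OF Suc.IH q] that by simp
  qed (use p that rec_eval.intros(6) in simp)
  then have "rec_eval Q (PrimRec p q) xs (rec_nat (f (tl xs)) (\<lambda>i y. g (i # y # tl xs)) (hd xs))"
    if "length xs = Suc k" for xs
    using that by (cases xs) auto
  then show ?thesis
    unfolding computable_def by blast
qed

lemma computable_rec1:
  assumes "computable Q 2 (\<lambda>xs. g (xs ! 0) (xs ! 1))" "computable Q k f"
  shows "computable Q k (\<lambda>xs. rec_nat c g (f xs))"
proof (rule computable_compose1[OF _ assms(2)])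
  let ?f = "\<lambda>xs. rec_nat c (\<lambda>i y. g ((i # y # tl xs) ! 0) ((i # y # tl xs) ! 1)) (hd xs)"
  have "computable Q (Suc 0) ?f"
    using assms(1) by (intro computable_PrimRec computable_const) (simp add: numeral_2_eq_2)
  then have "computable Q 1 ?f"
    by (simp only: One_nat_def)
  then show "computable Q 1 (\<lambda>xs. rec_nat c g (xs ! 0))"
    by (rule computable_cong) (auto simp: length_Suc_conv)
qed

lemma computable_rec2:
  assumes "computable Q 1 (\<lambda>xs. b (xs ! 0))" "computable Q 3 (\<lambda>xs. g (xs ! 0) (xs ! 1) (xs ! 2))"
    "computable Q k f" "computable Q k h"
  shows "computable Q k (\<lambda>xs. rec_nat (b (h xs)) (\<lambda>i y. g i y (h xs)) (f xs))"
proof (rule computable_compose2[of Q "\<lambda>n x. rec_nat (b x) (\<lambda>i y. g i y x) n", OF _ assms(3,4)])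
  have "computable Q (Suc 1) (\<lambda>xs. rec_nat (b (tl xs ! 0))
      (\<lambda>i y. g ((i # y # tl xs) ! 0) ((i # y # tl xs) ! 1) ((i # y # tl xs) ! 2)) (hd xs))"
    using assms(1,2) by (intro computable_PrimRec) (simp_all add: numeral_3_eq_3)
  then have "computable Q 2 (\<lambda>xs. rec_nat (b (tl xs ! 0))
      (\<lambda>i y. g ((i # y # tl xs) ! 0) ((i # y # tl xs) ! 1) ((i # y # tl xs) ! 2)) (hd xs))"
    by (simp only: Suc_1)
  then show "computable Q 2 (\<lambda>xs. rec_nat (b (xs ! 1)) (\<lambda>i y. g i y (xs ! 1)) (xs ! 0))"
    by (rule computable_cong) (auto simp: length_Suc_conv numeral_2_eq_2)
qed

lemma computable_iterate:
  assumes "computable Q 1 (\<lambda>xs. g (xs ! 0))" "computable Q k f" "computable Q k h"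
  shows "computable Q k (\<lambda>xs. (g ^^ f xs) (h xs))"
proof -
  have "computable Q k (\<lambda>xs. rec_nat (h xs) (\<lambda>i y. g y) (f xs))"
    by (intro computable_rec2[of Q "\<lambda>x. x" "\<lambda>i y x. g y"] computable_nth
        computable_compose1[OF assms(1)] assms) simp_all
  moreover have "rec_nat x (\<lambda>i y. g y) n = (g ^^ n) x" for x n
    by (induction n) auto
  ultimately show ?thesis
    by simp
qed

lemma computable_if [computable_intros]:
  assumes "computable Q k c" "computable Q k f" "computable Q k g"
  shows "computable Q k (\<lambda>xs. if c xs = 0 then f xs else g xs)"
proof -
  let ?F = "\<lambda>c x y. if c = (0::nat) then x else y :: nat"
  have "computable Q 3 (\<lambda>xs. ?F (xs ! 0) (xs ! 1) (xs ! 2))"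
  proof -
    have "computable Q (Suc 2) (\<lambda>xs. rec_nat (tl xs ! 0) (\<lambda>i y. (i # y # tl xs) ! 3) (hd xs))"
      by (intro computable_PrimRec computable_nth) simp_all
    then have "computable Q 3 (\<lambda>xs. rec_nat (tl xs ! 0) (\<lambda>i y. (i # y # tl xs) ! 3) (hd xs))"
      by (simp add: numeral_3_eq_3 numeral_2_eq_2)
    then show ?thesis
    proof (rule computable_cong)
      fix xs :: "nat list"
      assume "length xs = 3"
      then obtain c x y where xs: "xs = [c, x, y]"
        by (auto simp: length_Suc_conv numeral_3_eq_3)
      show "rec_nat (tl xs ! 0) (\<lambda>i y. (i # y # tl xs) ! 3) (hd xs) = ?F (xs ! 0) (xs ! 1) (xs ! 2)"
        unfolding xs by (cases c) (auto simp: numeral_3_eq_3 numeral_2_eq_2)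
    qed
  qed
  from computable_compose3[OF this assms] show ?thesis .
qed

lemma computable_add [computable_intros]:
  assumes "computable Q k f" "computable Q k g"
  shows "computable Q k (\<lambda>xs. f xs + g xs)"
proof -
  have "computable Q k (\<lambda>xs. (Suc ^^ f xs) (g xs))"
    by (intro computable_iterate computable_intros assms) simp
  moreover have "(Suc ^^ m) n = m + n" for m n
    by (induction m) auto
  ultimately show ?thesis
    by simp
qed

lemma computable_diff [computable_intros]:
  assumes "computable Q k f" "computable Q k g"
  shows "computable Q k (\<lambda>xs. f xs - g xs)"
proof -
  have pred: "computable Q 1 (\<lambda>xs. rec_nat 0 (\<lambda>i y. i) (xs ! 0))"
    by (intro computable_rec1 computable_intros) simp_all
  have "computable Q k (\<lambda>xs. ((\<lambda>m. rec_nat 0 (\<lambda>i y. i) m) ^^ g xs) (f xs))"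
    using pred by (intro computable_iterate assms) 
  moreover have "((\<lambda>m. rec_nat 0 (\<lambda>i y. i) m) ^^ n) m = m - n" for m n :: nat
  proof (induction n)
    case (Suc n)
    then show ?case
      by (cases "m - n") auto
  qed simp
  ultimately show ?thesis
    by simp
qed

lemma computable_if_less [computable_intros]:
  assumes "computable Q k c" "computable Q k d" "computable Q k f" "computable Q k g"
  shows "computable Q k (\<lambda>xs. if c xs < d xs then f xs else g xs)"
proof -
  have "computable Q k (\<lambda>xs. if d xs - c xs = 0 then g xs else f xs)"
    by (intro computable_intros assms)
  then show ?thesis
    by (rule computable_cong) auto
qed

lemma computable_mult_const [computable_intros]:
  assumes "computable Q k f"
  shows "computable Q k (\<lambda>xs. c * f xs)"
proof (induction c)
  case (Suc c)
  then show ?case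
    using computable_add[OF assms Suc.IH] by simp
qed (simp add: computable_const)

lemma computable_triangle [computable_intros]:
  assumes "computable Q k f"
  shows "computable Q k (\<lambda>xs. triangle (f xs))"
proof -
  have "computable Q k (\<lambda>xs. rec_nat 0 (\<lambda>i y. y + Suc i) (f xs))"
    by (intro computable_rec1 computable_intros assms) simp_all
  moreover have "rec_nat 0 (\<lambda>i y. y + Suc i) n = triangle n" for n
    by (induction n) auto
  ultimately show ?thesis
    by simp
qed

lemma computable_prod_encode [computable_intros]:
  assumes "computable Q k f" "computable Q k g"
  shows "computable Q k (\<lambda>xs. prod_encode (f xs, g xs))"
  unfolding prod_encode_def by (simp, intro computable_intros assms)

text \<open>
  The number of the diagonal of the Cantor pairing on which \<open>n\<close> lies.
\<close>

definition triangle_root :: "nat \<Rightarrow> nat" where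
  "triangle_root = rec_nat 0 (\<lambda>i y. if Suc i < triangle (Suc y) then y else Suc y)"

lemma triangle_root: "triangle (triangle_root n) \<le> n \<and> n < triangle (Suc (triangle_root n))"
  by (induction n) (auto simp: triangle_root_def)

lemma prod_decode_eq:
  "prod_decode n = (n - triangle (triangle_root n), triangle_root n - (n - triangle (triangle_root n)))"
  (is "_ = (?x, ?y)")
proof -
  have "?x + ?y = triangle_root n" "triangle (triangle_root n) + ?x = n"
    using triangle_root[of n] by auto
  then have "prod_encode (?x, ?y) = n"
    by (simp add: prod_encode_def)
  then show ?thesis
    by (metis prod_encode_inverse)
qed

lemma computable_triangle_root [computable_intros]:
  assumes "computable Q k f"
  shows "computable Q k (\<lambda>xs. triangle_root (f xs))"
  unfolding triangle_root_def
  by (intro computable_rec1 computable_intros assms) simp_all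

lemma computable_fst_prod_decode [computable_intros]:
  assumes "computable Q k f"
  shows "computable Q k (\<lambda>xs. fst (prod_decode (f xs)))"
  unfolding prod_decode_eq fst_conv by (intro computable_intros assms)

lemma computable_snd_prod_decode [computable_intros]:
  assumes "computable Q k f"
  shows "computable Q k (\<lambda>xs. snd (prod_decode (f xs)))"
  unfolding prod_decode_eq snd_conv by (intro computable_intros assms)

lemma computable_mod2 [computable_intros]:
  assumes "computable Q k f"
  shows "computable Q k (\<lambda>xs. f xs mod 2)"
proof -
  have "computable Q k (\<lambda>xs. rec_nat 0 (\<lambda>i y. 1 - y) (f xs))"
    by (intro computable_rec1 computable_intros assms) simp_all
  moreover have "rec_nat 0 (\<lambda>i y. 1 - y) n = n mod 2" for n :: nat
    by (induction n) (auto simp: mod_Suc)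
  ultimately show ?thesis
    by simp
qed

lemma computable_div2 [computable_intros]:
  assumes "computable Q k f"
  shows "computable Q k (\<lambda>xs. f xs div 2)"
proof -
  have "computable Q k (\<lambda>xs. rec_nat 0 (\<lambda>i y. y + i mod 2) (f xs))"
    by (intro computable_rec1 computable_intros assms) simp_all
  moreover have "rec_nat 0 (\<lambda>i y. y + i mod 2) n = n div 2" for n :: nat
    by (induction n) (auto, presburger)
  ultimately show ?thesis
    by simp
qed

lemma computable_finite_table:
  "computable Q 1 (\<lambda>xs. if xs ! 0 < n then f (xs ! 0) else c)"
proof (induction n)
  case 0
  then show ?case
    by (simp add: computable_const)
next
  case (Suc n)
  have "computable Q 1 (\<lambda>xs. if xs ! 0 < n then (if xs ! 0 < n then f (xs ! 0) else c)
      else if n < xs ! 0 then c else f n)"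
    by (intro computable_intros Suc.IH) simp_all
  then show ?case
    by (rule computable_cong) (auto simp: less_Suc_eq not_less dest: le_antisym)
qed

text \<open>
  One step of a left fold over a list code. The state is the pair of the code of the remaining list
  and the accumulator; on the code 0 of the empty list the state is kept, so that any number of steps that
  is at least the length of the list gives the result.
\<close>

definition fold_step :: "(nat \<Rightarrow> nat \<Rightarrow> nat) \<Rightarrow> nat \<Rightarrow> nat" where
  "fold_step F s = (if fst (prod_decode s) = 0 then s else
     prod_encode (snd (prod_decode (fst (prod_decode s) - 1)),
       F (fst (prod_decode (fst (prod_decode s) - 1))) (snd (prod_decode s))))"

lemma funpow_fold_step:
  assumes "length l \<le> n"
  shows "(fold_step F ^^ n) (prod_encode (list_encode l, acc)) = prod_encode (0, fold F l acc)"
  using assms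
proof (induction n arbitrary: l acc)
  case (Suc n)
  show ?case
  proof (cases l)
    case Nil
    then show ?thesis
      using Suc.IH[of "[]" acc] by (simp add: funpow_swap1 fold_step_def)
  next
    case (Cons x l')
    have "fold_step F (prod_encode (list_encode l, acc)) = prod_encode (list_encode l', F x acc)"
      unfolding Cons fold_step_def by simp
    then show ?thesis
      using Suc.IH[of l' "F x acc"] Suc.prems Cons by (simp add: funpow_swap1)
  qed
qed simp

lemma length_le_list_encode: "length l \<le> list_encode l"
proof (induction l)
  case (Cons x l)
  then show ?case
    using le_prod_encode_2[of "list_encode l" x] by simp
qed simp

lemma computable_fold:
  assumes "computable Q 2 (\<lambda>xs. F (xs ! 0) (xs ! 1))" "computable Q k f" "computable Q k g"
  shows "computable Q k (\<lambda>xs. fold F (list_decode (f xs)) (g xs))"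
proof -
  have "computable Q 1 (\<lambda>xs. fold_step F (xs ! 0))"
    unfolding fold_step_def
    by (intro computable_compose2[OF assms(1)] computable_intros) simp_all
  then have "computable Q k (\<lambda>xs. snd (prod_decode ((fold_step F ^^ f xs) (prod_encode (f xs, g xs)))))"
    by (intro computable_iterate computable_intros assms)
  then show ?thesis
  proof (rule computable_cong)
    fix xs
    show "snd (prod_decode ((fold_step F ^^ f xs) (prod_encode (f xs, g xs)))) = fold F (list_decode (f xs)) (g xs)"
      using funpow_fold_step[OF length_le_list_encode[of "list_decode (f xs)"], of F "g xs"] by simp
  qed
qed

text \<open>
  A right fold is a left fold over the reversed list, and reversal is itself a left fold.
\<close>

lemma computable_foldr:
  assumes "computable Q 2 (\<lambda>xs. F (xs ! 0) (xs ! 1))" "computable Q k f" "computable Q k g"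
  shows "computable Q k (\<lambda>xs. foldr F (list_decode (f xs)) (g xs))"
proof -
  have rev: "fold (\<lambda>x l. Suc (prod_encode (x, l))) l (list_encode l') = list_encode (rev l @ l')" for l l'
    by (induction l arbitrary: l') (simp_all flip: list_encode.simps)
  have "computable Q k (\<lambda>xs. fold F (list_decode
      (fold (\<lambda>x l. Suc (prod_encode (x, l))) (list_decode (f xs)) 0)) (g xs))"
    by (intro computable_fold assms computable_intros) simp_all
  then show ?thesis
    using rev[of _ "[]"] by (simp add: foldr_conv_fold)
qed

section \<open>Codes of systems\<close>

lemma symb_code_map: "symb_code num s = symb_code id (map_symb (map num) s)"
  by (cases s) simp_all

lemma word_code_map: "word_code num w = word_code id (map (map_symb (map num)) w)"
proof -
  have "symb_code num = symb_code id \<circ> map_symb (map num)"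
    unfolding comp_def by (rule ext) (rule symb_code_map)
  then show ?thesis
    by (simp add: word_code_def)
qed

lemma equation_code_map: "equation_code num e = equation_code id (map_equation (map num) e)"
  using word_code_map[of num] by (cases e) simp_all

lemma system_code_map: "system_code num \<Sigma> = system_code id (map (map_equation (map num)) \<Sigma>)"
proof -
  have "equation_code num = equation_code id \<circ> map_equation (map num)"
    unfolding comp_def by (rule ext) (rule equation_code_map)
  then show ?thesis
    by (simp add: system_code_def)
qed

lemma equation_code_map_equation:
  "equation_code num (map_equation (map h) e) = equation_code (num \<circ> h) e"
  by (subst (1 2) equation_code_map) (simp add: equation.map_comp comp_def)

lemma inj_symb_code: "inj (symb_code id)"
proof (rule injI)
  fix s t :: "nat list symb"
  assume "symb_code id s = symb_code id t"
  then show "s = t"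
    by (cases s; cases t) (simp_all add: sum_encode_eq list_encode_eq)
qed

lemma inj_word_code: "inj (word_code id)"
  by (rule injI) (simp add: word_code_def list_encode_eq inj_map_eq_map[OF inj_symb_code])

lemma inj_equation_code: "inj (equation_code id)"
proof (rule injI)
  fix e f :: "nat list equation"
  assume "equation_code id e = equation_code id f"
  then show "e = f"
    by (cases e; cases f) (simp_all add: sum_encode_eq prod_encode_eq inj_eq[OF inj_word_code])
qed

lemma inj_system_code: "inj (system_code id)"
  by (rule injI) (simp add: system_code_def list_encode_eq inj_map_eq_map[OF inj_equation_code])

lemma surj_symb_code: "\<exists>s. x = symb_code id s"
proof (cases "sum_decode x")
  case (Inl i)
  then have "x = symb_code id (Var i)"
    by (metis sum_decode_inverse symb_code.simps(1))
  then show ?thesis ..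
next
  case (Inr l)
  then have "x = symb_code id (Coef (list_decode l))"
    by (metis list.map_id list_decode_inverse sum_decode_inverse symb_code.simps(2))
  then show ?thesis ..
qed

lemma surj_map_list_encode:
  assumes "\<And>x::nat. \<exists>s. x = f s"
  shows "\<exists>w. x = list_encode (map f w)"
proof -
  have "\<exists>w. l = map f w" for l
  proof (induction l)
    case (Cons y l)
    then obtain w s where "l = map f w" "y = f s"
      using assms by blast
    then show ?case
      by (intro exI[of _ "s # w"]) simp
  qed simp
  then show ?thesis
    by (metis list_decode_inverse)
qed

lemma surj_equation_code: "\<exists>e. x = equation_code id e"
proof -
  have w: "\<exists>u. y = word_code id u" for y
    unfolding word_code_def by (rule surj_map_list_encode) (rule surj_symb_code)
  show ?thesis
  proof (cases "sum_decode x")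
    case (Inl p)
    obtain u v where "fst (prod_decode p) = word_code id u" "snd (prod_decode p) = word_code id v"
      using w by blast
    then have "x = equation_code id (Eq u v)"
      using Inl by (metis equation_code.simps(1) prod.collapse prod_decode_inverse sum_decode_inverse)
    then show ?thesis ..
  next
    case (Inr p)
    obtain i q where p: "prod_decode p = (i, q)"
      by fastforce
    obtain u v where "fst (prod_decode q) = word_code id u" "snd (prod_decode q) = word_code id v"
      using w by blast
    then have "x = equation_code id (Rel i u v)"
      using Inr p by (metis equation_code.simps(2) prod.collapse prod_decode_inverse sum_decode_inverse)
    then show ?thesis ..
  qed
qed

text \<open>
  There are no numbers to treat beside the codes of systems over the letters \<open>\<nat>\<close>, so a
  translation of codes can be described by a translation of systems.
\<close>

lemma surj_system_code: "\<exists>\<Sigma>. x = system_code id \<Sigma>"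
  unfolding system_code_def by (rule surj_map_list_encode) (rule surj_equation_code)

lemma less_list_encode: "x \<in> set l \<Longrightarrow> x < list_encode l"
proof (induction l)
  case (Cons y l)
  then show ?case
    using le_prod_encode_1[of y "list_encode l"] le_prod_encode_2[of "list_encode l" y] by fastforce
qed simp

lemma le_sum_encode: "x \<le> sum_encode (Inl x)" "x \<le> sum_encode (Inr x)"
  by (simp_all add: sum_encode_def)

lemma var_less_word_code: "Var i \<in> set w \<Longrightarrow> i < word_code num w"
proof -
  assume "Var i \<in> set w"
  then have "symb_code num (Var i) \<in> set (map (symb_code num) w)"
    by (metis image_eqI set_map)
  then have "symb_code num (Var i) < word_code num w"
    unfolding word_code_def by (rule less_list_encode)
  then show ?thesis
    using le_sum_encode(1)[of i] by simp
qed

lemma equation_vars_less_code: "i \<in> equation_vars e \<Longrightarrow> i < equation_code num e"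
proof (cases e)
  case (Eq u v)
  assume "i \<in> equation_vars e"
  then have "i < word_code num u \<or> i < word_code num v"
    using Eq var_less_word_code by auto
  then have "i < prod_encode (word_code num u, word_code num v)"
    by (meson le_prod_encode_1 le_prod_encode_2 less_le_trans)
  then show ?thesis
    using Eq le_sum_encode(1) less_le_trans by (metis equation_code.simps(1))
next
  case (Rel k u v)
  assume "i \<in> equation_vars e"
  then have "i < word_code num u \<or> i < word_code num v"
    using Rel var_less_word_code by auto
  then have "i < prod_encode (k, prod_encode (word_code num u, word_code num v))"
    by (meson le_prod_encode_1 le_prod_encode_2 less_le_trans)
  then show ?thesis
    using Rel le_sum_encode(2) less_le_trans by (metis equation_code.simps(2))
qed

lemma equation_vars_less_system_code: "e \<in> set \<Sigma> \<Longrightarrow> equation_vars e \<subseteq> {..<system_code num \<Sigma>}"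
  using equation_vars_less_code less_list_encode[of "equation_code num e" "map (equation_code num) \<Sigma>"]
  unfolding system_code_def by (fastforce intro: less_trans)

section \<open>Naturality of the translation\<close>

lemma translate_symb_natural:
  "map (map_symb g) (translate_symb \<omega> s) = translate_symb (g \<circ> \<omega>) s"
  "translate_symb \<omega> (map_symb (map h) s) = translate_symb (\<omega> \<circ> h) s"
  by (cases s; simp)+

lemma translate_word_natural:
  "map (map_symb g) (translate_word \<omega> w) = translate_word (g \<circ> \<omega>) w"
  "translate_word \<omega> (map (map_symb (map h)) w) = translate_word (\<omega> \<circ> h) w"
  by (simp_all add: translate_word_def map_concat comp_def translate_symb_natural)

lemma length_system_natural:
  "map (map_equation g) (length_system c i j) = length_system (g c) i j"
  "map (map_equation g) (length_le_system c i j u v) =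
    length_le_system (g c) i j (map (map_symb g) u) (map (map_symb g) v)"
  by (simp_all add: length_system_def length_le_system_def commutes_eq_def)

lemma translate_equation_natural:
  "map (map_equation g) (translate_equation \<omega> c m e) = translate_equation (g \<circ> \<omega>) (g c) m e"
  "translate_equation \<omega> c m (map_equation (map h) e) = translate_equation (\<omega> \<circ> h) c m e"
  by (cases e; simp add: translate_word_natural length_system_natural)+

text \<open>
  Renaming letters before or after the translation amounts to changing \<open>\<omega>\<close>. This links the
  translation of codes, where letters are numbers, with the one of systems over words.
\<close>

lemma translate_system_natural:
  "map (map_equation g) (translate_system num \<omega> c N \<Sigma>) = translate_system num (g \<circ> \<omega>) (g c) N \<Sigma>"
  "translate_system num \<omega> c N (map (map_equation (map h)) \<Sigma>) = translate_system (num \<circ> h) (\<omega> \<circ> h) c N \<Sigma>"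
  by (simp_all add: translate_system_def map_concat comp_def translate_equation_natural[unfolded comp_def]
      length_system_natural equation_code_map_equation[unfolded comp_def])

lemma translate_symb_cong:
  assumes "set_symb s \<subseteq> lists B" "\<And>k. k \<in> B \<Longrightarrow> \<omega> k = \<omega>' k"
  shows "translate_symb \<omega> s = translate_symb \<omega>' s"
  using assms by (cases s) (auto simp: in_lists_conv_set)

lemma translate_word_cong:
  assumes "(\<Union>s\<in>set w. set_symb s) \<subseteq> lists B" "\<And>k. k \<in> B \<Longrightarrow> \<omega> k = \<omega>' k"
  shows "translate_word \<omega> w = translate_word \<omega>' w"
proof -
  have "translate_symb \<omega> s = translate_symb \<omega>' s" if "s \<in> set w" for s
    using assms that by (intro translate_symb_cong[of s B]) blast+
  then show ?thesis
    unfolding translate_word_def by (metis (no_types, lifting) map_cong)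
qed

lemma translate_system_cong:
  assumes "system_over D (lists B) \<Sigma>" "\<And>k. k \<in> B \<Longrightarrow> \<omega> k = \<omega>' k"
  shows "translate_system num \<omega> c N \<Sigma> = translate_system num \<omega>' c N \<Sigma>"
proof -
  have "translate_equation \<omega> c m e = translate_equation \<omega>' c m e" if "e \<in> set \<Sigma>" for e m
  proof -
    have e: "equation_over D (lists B) e"
      using assms(1) that by (simp add: system_over_def)
    have w: "translate_word \<omega> w = translate_word \<omega>' w" if "(\<Union>s\<in>set w. set_symb s) \<subseteq> lists B" for w
      using that assms(2) by (rule translate_word_cong)
    show ?thesis
    proof (cases e)
      case (Eq u v)
      then show ?thesis
        using e w[of u] w[of v] by simp
    next
      case (Rel i u v)
      then show ?thesis
        using e w[of u] w[of v] by simp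
    qed
  qed
  then show ?thesis
    unfolding translate_system_def by (metis (no_types, lifting) map_cong)
qed

section \<open>The translation on codes\<close>

abbreviation code_Cons :: "nat \<Rightarrow> nat \<Rightarrow> nat" where
  "code_Cons x l \<equiv> Suc (prod_encode (x, l))"

abbreviation code_Eq :: "nat \<Rightarrow> nat \<Rightarrow> nat" where
  "code_Eq u v \<equiv> 2 * prod_encode (u, v)"

abbreviation code_commutes :: "nat \<Rightarrow> nat \<Rightarrow> nat" where
  "code_commutes C s \<equiv> code_Eq (code_Cons s (code_Cons C 0)) (code_Cons C (code_Cons s 0))"

text \<open>
  The following functions perform the translation on codes. Each one prepends its output to the code
  \<open>acc\<close> of the output produced so far, so that the recursion over lists is a right fold. The codes of
  \<^term>\<open>Var i\<close> and \<^term>\<open>Var (4 * i)\<close> are \<^term>\<open>2 * i\<close> and \<^term>\<open>4 * (2 * i)\<close>; \<open>T k\<close> is the code of the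
  coefficient \<open>\<omega> k\<close>.
\<close>

definition code_translate_symb :: "(nat \<Rightarrow> nat) \<Rightarrow> nat \<Rightarrow> nat \<Rightarrow> nat" where
  "code_translate_symb T s acc = (if s mod 2 = 0 then code_Cons (4 * s) acc
     else foldr (\<lambda>k acc. code_Cons (T k) acc) (list_decode (s div 2)) acc)"

definition code_translate_word :: "(nat \<Rightarrow> nat) \<Rightarrow> nat \<Rightarrow> nat \<Rightarrow> nat" where
  "code_translate_word T w acc = foldr (code_translate_symb T) (list_decode w) acc"

definition code_translate_equation :: "(nat \<Rightarrow> nat) \<Rightarrow> nat \<Rightarrow> nat \<Rightarrow> nat \<Rightarrow> nat" where
  "code_translate_equation T C e acc =
    (if e mod 2 = 0 then
       code_Cons (code_Eq (code_translate_word T (fst (prod_decode (e div 2))) 0)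
         (code_translate_word T (snd (prod_decode (e div 2))) 0)) acc
     else if fst (prod_decode (e div 2)) = 0 then
       code_Cons (code_commutes C (2 * (4 * e + 2)))
       (code_Cons (code_Eq (code_Cons (2 * (4 * e + 2))
           (code_translate_word T (fst (prod_decode (snd (prod_decode (e div 2))))) 0)) 0)
       (code_Cons (code_commutes C (2 * (4 * e + 3)))
       (code_Cons (code_Eq (code_Cons (2 * (4 * e + 3)) (code_Cons (2 * (4 * e + 2))
           (code_translate_word T (snd (prod_decode (snd (prod_decode (e div 2))))) 0))) 0) acc)))
     else code_Cons (equation_code id (Rel 0 [] [])) acc)"

definition code_variable_system :: "nat \<Rightarrow> nat \<Rightarrow> nat \<Rightarrow> nat" where
  "code_variable_system C i acc =
    code_Cons (code_commutes C (2 * (4 * i + 1)))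
      (code_Cons (code_Eq (code_Cons (2 * (4 * i + 1)) (code_Cons (2 * (4 * i)) 0)) 0) acc)"

text \<open>
  The code \<open>x\<close> serves as bound for the variables of the system that it codes.
\<close>

definition code_translate_system :: "(nat \<Rightarrow> nat) \<Rightarrow> nat \<Rightarrow> nat \<Rightarrow> nat" where
  "code_translate_system T C x =
    foldr (code_translate_equation T C) (list_decode x) (rec_nat 0 (code_variable_system C) x)"

lemma computable_code_translate_system:
  assumes T: "computable Q 1 (\<lambda>xs. T (xs ! 0))"
  shows "computable Q 1 (\<lambda>xs. code_translate_system T C (xs ! 0))"
proof -
  have symb: "computable Q 2 (\<lambda>xs. code_translate_symb T (xs ! 0) (xs ! 1))"
    unfolding code_translate_symb_def
    by (intro computable_foldr computable_compose1[OF T] computable_intros) simp_all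
  have word: "computable Q k (\<lambda>xs. code_translate_word T (f xs) (g xs))"
    if "computable Q k f" "computable Q k g" for k f g
    unfolding code_translate_word_def by (intro computable_foldr symb that)
  have equation: "computable Q 2 (\<lambda>xs. code_translate_equation T C (xs ! 0) (xs ! 1))"
    unfolding code_translate_equation_def
    by (intro word computable_intros) simp_all
  have "computable Q 2 (\<lambda>xs. code_variable_system C (xs ! 0) (xs ! 1))"
    unfolding code_variable_system_def by (intro computable_intros) simp_all
  then show ?thesis
    unfolding code_translate_system_def
    by (intro computable_foldr computable_rec1 equation computable_intros) simp_all
qed

lemma sum_encode_simps: "sum_encode (Inl x) = 2 * x" "sum_encode (Inr x) = Suc (2 * x)"
  by (simp_all add: sum_encode_def)

lemma word_code_Cons:
  "word_code num [] = 0" "word_code num (s # w) = code_Cons (symb_code num s) (word_code num w)"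
  by (simp_all add: word_code_def)

lemma code_translate_symb:
  assumes T: "\<And>k. T k = symb_code id (Coef (\<omega> k))"
  shows "code_translate_symb T (symb_code id s) (word_code id w) = word_code id (translate_symb \<omega> s @ w)"
proof (cases s)
  case (Var i)
  then show ?thesis
    by (simp add: code_translate_symb_def sum_encode_simps word_code_def)
next
  case (Coef v)
  have "foldr (\<lambda>k acc. code_Cons (T k) acc) v (word_code id w)
      = word_code id (map (\<lambda>k. Coef (\<omega> k)) v @ w)"
    by (induction v) (simp_all add: T word_code_def)
  then show ?thesis
    using Coef by (simp add: code_translate_symb_def sum_encode_simps)
qed

lemma code_translate_word:
  assumes T: "\<And>k. T k = symb_code id (Coef (\<omega> k))"
  shows "code_translate_word T (word_code id u) (word_code id w) = word_code id (translate_word \<omega> u @ w)"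
proof (induction u)
  case (Cons s u)
  have "code_translate_word T (word_code id (s # u)) (word_code id w)
      = code_translate_symb T (symb_code id s) (code_translate_word T (word_code id u) (word_code id w))"
    by (simp add: code_translate_word_def word_code_def)
  then show ?case
    unfolding Cons.IH code_translate_symb[of T \<omega>, OF T] by (simp add: translate_word_def id_def)
qed (simp add: code_translate_word_def translate_word_def word_code_def)

lemma code_translate_equation:
  assumes T: "\<And>k. T k = symb_code id (Coef (\<omega> k))" and C: "C = symb_code id (Coef c)"
  shows "code_translate_equation T C (equation_code id e) (system_code id \<Sigma>)
    = system_code id (translate_equation \<omega> c (equation_code id e) e @ \<Sigma>)"
proof -
  have w: "code_translate_word T (word_code id u) 0 = word_code id (translate_word \<omega> u)" for u
    using code_translate_word[of T \<omega> u "[]", OF T] by (simp add: word_code_def)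
  show ?thesis
  proof (cases e)
    case (Eq u v)
    then show ?thesis
      by (simp add: code_translate_equation_def sum_encode_simps w system_code_def)
  next
    case (Rel i u v)
    define m where "m = equation_code id e"
    have m: "m mod 2 \<noteq> 0" "m div 2 = prod_encode (i, prod_encode (word_code id u, word_code id v))"
      using Rel by (simp_all add: m_def sum_encode_simps)
    have "code_translate_equation T C m (system_code id \<Sigma>) = system_code id (translate_equation \<omega> c m e @ \<Sigma>)"
      using m unfolding code_translate_equation_def
      by (simp add: Rel w system_code_def length_le_system_def commutes_eq_def word_code_Cons
          sum_encode_simps C)
    then show ?thesis
      by (simp only: m_def)
  qed
qed

lemma code_translate_system:
  assumes T: "\<And>k. T k = symb_code id (Coef (\<omega> k))" and C: "C = symb_code id (Coef c)"
  shows "code_translate_system T C (system_code id \<Sigma>)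
    = system_code id (translate_system id \<omega> c (system_code id \<Sigma>) \<Sigma>)"
proof -
  let ?vars = "\<lambda>N. concat (map (\<lambda>i. length_system c (4 * i) (4 * i + 1)) (rev [0..<N]))"
  have vars: "rec_nat 0 (code_variable_system C) N = system_code id (?vars N)" for N
  proof (induction N)
    case (Suc N)
    then show ?case
      by (simp add: code_variable_system_def system_code_def length_system_def commutes_eq_def word_code_def
          sum_encode_simps C)
  qed (simp add: system_code_def)
  have "foldr (code_translate_equation T C) (map (equation_code id) \<Sigma>') (system_code id R)
      = system_code id (concat (map (\<lambda>e. translate_equation \<omega> c (equation_code id e) e) \<Sigma>') @ R)" for \<Sigma>' R
  proof (induction \<Sigma>')
    case (Cons e \<Sigma>')
    then show ?case
      using code_translate_equation[of T \<omega> C c e, OF T C] by (simp add: id_def)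
  qed simp
  then show ?thesis
    unfolding code_translate_system_def vars translate_system_def
    by (simp add: system_code_def[of id \<Sigma>])
qed

section \<open>Reducing the Diophantine problem\<close>

lemma system_over_map_equation:
  fixes f :: "'a \<Rightarrow> 'b"
  assumes "f ` A \<subseteq> B" "system_over M (lists A) \<Sigma>"
  shows "system_over M (lists B) (map (map_equation (map f)) \<Sigma>)"
proof -
  have w: "(\<Union>s\<in>set (map (map_symb (map f)) w). set_symb s) \<subseteq> lists B"
    if "(\<Union>s\<in>set w. set_symb s) \<subseteq> lists A" for w :: "'a list symb list"
  proof -
    have "map f v \<in> lists B" if "v \<in> lists A" for v
      using that assms(1) by (auto simp: in_lists_conv_set)
    then show ?thesis
      using that by (force simp: symb.set_map)
  qed
  have "equation_over M (lists B) (map_equation (map f) e)" if "equation_over M (lists A) e" for e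
    using that w by (cases e) (simp_all del: set_map add: UN_Un)
  then show ?thesis
    using assms(2) by (simp add: system_over_def)
qed

lemma map_equation_inverse:
  assumes "\<And>k. k \<in> A \<Longrightarrow> g (f k) = k" "system_over M (lists A) \<Sigma>"
  shows "map (map_equation (map g)) (map (map_equation (map f)) \<Sigma>) = \<Sigma>"
proof -
  have l: "map (g \<circ> f) v = v" if "v \<in> lists A" for v
    using that assms(1) by (intro map_idI) (auto simp: in_lists_conv_set)
  have s: "map_symb (map g \<circ> map f) s = s" if "set_symb s \<subseteq> lists A" for s
    using that l by (cases s) simp_all
  have w: "map (map_symb (map g \<circ> map f)) w = w" if "(\<Union>s\<in>set w. set_symb s) \<subseteq> lists A" for w
    using that s by (intro map_idI) blast
  have "map_equation (map g \<circ> map f) e = e" if "equation_over M (lists A) e" for e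
    using that w by (cases e) (simp_all add: UN_Un)
  then show ?thesis
    using assms(2) by (simp add: system_over_def equation.map_comp map_idI)
qed

lemma translate_word_over:
  assumes "(\<Union>s\<in>set (translate_word \<omega> w). set_symb s) \<subseteq> lists B" "\<And>k. \<omega> k \<in> lists B \<Longrightarrow> k < n"
  shows "(\<Union>s\<in>set w. set_symb s) \<subseteq> lists {..<n}"
proof (rule UN_least)
  fix s
  assume s: "s \<in> set w"
  show "set_symb s \<subseteq> lists {..<n}"
  proof (cases s)
    case (Coef v)
    have "k < n" if "k \<in> set v" for k
    proof -
      have "Coef (\<omega> k) \<in> set (translate_word \<omega> w)"
        unfolding translate_word_def using s Coef that by force
      then have "\<omega> k \<in> lists B"
        using assms(1) by force
      then show ?thesis
        by (rule assms(2))
    qed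
    then show ?thesis
      using Coef by (simp add: in_lists_conv_set)
  qed simp
qed

context length_as_right_inverse
begin

text \<open>
  If \<open>\<omega>\<close> sends wrong letters to wrong coefficients, the translation detects systems that are not
  well-formed.
\<close>

lemma translate_system_over_imp:
  assumes "rels M = []" "\<And>k. \<omega> k \<in> lists B \<Longrightarrow> k < n"
    "system_over M (lists B) (translate_system num \<omega> c N \<Sigma>)"
  shows "system_over D (lists {..<n}) \<Sigma>"
  unfolding system_over_def
proof
  fix e
  assume e: "e \<in> set \<Sigma>"
  then have *: "\<forall>e'\<in>set (translate_equation \<omega> c (equation_code num e) e). equation_over M (lists B) e'"
    using assms(3) by (simp add: system_over_def translate_system_def ball_Un)
  note w = translate_word_over[of \<omega> _ B, OF _ assms(2)]
  show "equation_over D (lists {..<n}) e"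
  proof (cases e)
    case (Eq u v)
    then show ?thesis
      using * w[of u] w[of v] by (simp add: UN_Un)
  next
    case (Rel i u v)
    then have "i = 0"
      using * assms(1) by (cases "i = 0") simp_all
    then show ?thesis
      using Rel * w[of u] w[of v] by (simp add: UN_Un length_le_system_def)
  qed
qed

lemma translate_word_over_target:
  assumes "(\<Union>s\<in>set w. set_symb s) \<subseteq> lists {..<n}" "\<And>k. k < n \<Longrightarrow> \<omega> k \<in> C"
  shows "(\<Union>s\<in>set (translate_word \<omega> w). set_symb s) \<subseteq> C"
proof -
  have "(\<Union>t\<in>set (translate_symb \<omega> s). set_symb t) \<subseteq> C" if "s \<in> set w" for s
  proof (cases s)
    case (Coef v)
    then have "v \<in> lists {..<n}"
      using assms(1) that by force
    then show ?thesis
      using Coef assms(2) by (auto simp: in_lists_conv_set)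
  qed simp
  then show ?thesis
    unfolding translate_word_def by (simp add: UN_subset_iff)
qed

lemma translate_system_over:
  assumes "system_over D (lists {..<n}) \<Sigma>" "\<And>k. k < n \<Longrightarrow> \<omega> k \<in> C" "c \<in> C"
  shows "system_over M C (translate_system num \<omega> c N \<Sigma>)"
proof -
  have "\<forall>e'\<in>set (translate_equation \<omega> c m e). equation_over M C e'" if "e \<in> set \<Sigma>" for m e
  proof -
    have e: "equation_over D (lists {..<n}) e"
      using assms(1) that by (simp add: system_over_def)
    note w = translate_word_over_target[of _ \<omega> C, OF _ assms(2)]
    show ?thesis
    proof (cases e)
      case (Eq u v)
      then show ?thesis
        using e w[of u] w[of v] by (simp add: UN_Un)
    next
      case (Rel i u v)
      then show ?thesis
        using e w[of u] w[of v] assms(3) by (simp add: UN_Un length_le_system_def commutes_eq_def)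
    qed
  qed
  then show ?thesis
    using assms(3) by (auto simp: system_over_def translate_system_def ball_Un length_system_def commutes_eq_def)
qed

text \<open>
  The letters of codes are numbered by the unspecified bijections \<^const>\<open>to_nat_on\<close>, so the table \<open>\<omega>\<close> sends
  the number of a letter to the numbered word of its generator, and numbers without a letter
  to the number \<^term>\<open>card A\<close>, which no letter in \<open>A\<close> has. As \<open>\<omega>\<close> is a finite table, the translation is computable.
\<close>

theorem diophantine_problem_reducible:
  fixes \<iota> :: "'a list \<Rightarrow> 'u"
  assumes "rels M = []" "finite A"
    and gen: "\<And>k. k < n \<Longrightarrow> gen k \<in> lists A \<and> \<iota> (gen k) = embed [k]"
    and c: "c \<in> lists A" "\<iota> c = \<alpha>"
  shows "turing_reducible (diophantine_free_with_length n len) (diophantine_problem M A \<iota>)"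
proof -
  define \<pi> where "\<pi> = to_nat_on {..<n}"
  define \<nu> where "\<nu> = to_nat_on A"
  have "bij_betw \<pi> {..<n} {..<n}"
    using to_nat_on_finite[of "{..<n}"] by (simp add: \<pi>_def)
  then have \<pi>: "inj_on \<pi> {..<n}" "\<pi> ` {..<n} = {..<n}"
    by (simp_all add: bij_betw_def)
  have "bij_betw \<nu> A {..<card A}"
    using to_nat_on_finite[OF assms(2)] by (simp add: \<nu>_def)
  then have \<nu>: "inj_on \<nu> A" "\<nu> ` A = {..<card A}"
    by (simp_all add: bij_betw_def)
  define \<omega> where "\<omega> k = (if k < n then map \<nu> (gen (inv_into {..<n} \<pi> k)) else [card A])" for k
  define T where "T k = symb_code id (Coef (\<omega> k))" for k
  define h where "h = code_translate_system T (symb_code id (Coef (map \<nu> c)))"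
  define P where "P = diophantine_free_with_length n len"
  define Q where "Q = diophantine_problem M A \<iota>"
  have h: "h (system_code id \<Sigma>) = system_code id (translate_system id \<omega> (map \<nu> c) (system_code id \<Sigma>) \<Sigma>)" for \<Sigma>
    unfolding h_def by (rule code_translate_system) (simp_all only: T_def)
  have \<omega>_less: "k < n" if "\<omega> k \<in> lists {..<card A}" for k
    using that by (simp add: \<omega>_def split: if_splits)
  let ?tr = "\<lambda>\<Sigma>. translate_system \<pi> gen c (system_code \<pi> \<Sigma>) \<Sigma>"
  have wf: "h (system_code \<pi> \<Sigma>) = system_code \<nu> (?tr \<Sigma>)"
    "(\<exists>\<sigma>. solves D (\<lambda>w. w) \<sigma> \<Sigma>) \<longleftrightarrow> (\<exists>\<tau>. solves M \<iota> \<tau> (?tr \<Sigma>))"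
    "system_over M (lists A) (?tr \<Sigma>)"
    if \<Sigma>: "system_over D (lists {..<n}) \<Sigma>" for \<Sigma>
  proof -
    have "h (system_code \<pi> \<Sigma>) = h (system_code id (map (map_equation (map \<pi>)) \<Sigma>))"
      by (simp only: system_code_map[of \<pi>])
    also have "\<dots> = system_code id (translate_system id \<omega> (map \<nu> c) (system_code \<pi> \<Sigma>)
        (map (map_equation (map \<pi>)) \<Sigma>))"
      by (simp only: h system_code_map[of \<pi>])
    also have "\<dots> = system_code id (translate_system \<pi> (\<omega> \<circ> \<pi>) (map \<nu> c) (system_code \<pi> \<Sigma>) \<Sigma>)"
      by (simp only: translate_system_natural(2) id_comp)
    also have "translate_system \<pi> (\<omega> \<circ> \<pi>) (map \<nu> c) (system_code \<pi> \<Sigma>) \<Sigma>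
        = translate_system \<pi> (map \<nu> \<circ> gen) (map \<nu> c) (system_code \<pi> \<Sigma>) \<Sigma>"
    proof (rule translate_system_cong[OF \<Sigma>])
      fix k
      assume k: "k \<in> {..<n}"
      then have "\<pi> k < n"
        using \<pi>(2) by blast
      then show "(\<omega> \<circ> \<pi>) k = (map \<nu> \<circ> gen) k"
        using inv_into_f_f[OF \<pi>(1) k] by (simp add: \<omega>_def)
    qed
    also have "\<dots> = map (map_equation (map \<nu>)) (?tr \<Sigma>)"
      by (simp only: translate_system_natural(1))
    finally show "h (system_code \<pi> \<Sigma>) = system_code \<nu> (?tr \<Sigma>)"
      by (simp only: system_code_map[of \<nu>])
    have "map (map_equation (map (inv_into {..<n} \<pi>))) (map (map_equation (map \<pi>)) \<Sigma>) = \<Sigma>"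
      by (rule map_equation_inverse[OF _ \<Sigma>]) (rule inv_into_f_f[OF \<pi>(1)])
    then have "map_equation (map (inv_into {..<n} \<pi>)) (map_equation (map \<pi>) e) = e" if "e \<in> set \<Sigma>" for e
      using that map_eq_conv[of _ \<Sigma> id] by (simp only: map_map list.map_id comp_apply id_apply)
    then have "inj_on (map_equation (map \<pi>)) (set \<Sigma>)"
      by (rule inj_on_inverseI)
    then have "inj_on (equation_code id \<circ> map_equation (map \<pi>)) (set \<Sigma>)"
      by (rule comp_inj_on) (rule inj_on_subset[OF inj_equation_code subset_UNIV])
    then have "inj_on (equation_code \<pi>) (set \<Sigma>)"
      by (simp only: comp_def flip: equation_code_map)
    then show "(\<exists>\<sigma>. solves D (\<lambda>w. w) \<sigma> \<Sigma>) \<longleftrightarrow> (\<exists>\<tau>. solves M \<iota> \<tau> (?tr \<Sigma>))"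
      using gen c(2) \<Sigma> equation_vars_less_system_code[of _ \<Sigma> \<pi>]
        solvable_translate_system[of \<iota> gen c \<Sigma> "system_code \<pi> \<Sigma>" \<pi>] by simp
    show "system_over M (lists A) (?tr \<Sigma>)"
      using gen by (intro translate_system_over[of \<Sigma> gen "lists A" c, OF \<Sigma> _ c(1)]) simp
  qed
  have P_iff: "x \<in> P \<longleftrightarrow> (\<exists>\<Sigma>. x = system_code \<pi> \<Sigma> \<and> system_over D (lists {..<n}) \<Sigma> \<and>
      (\<exists>\<sigma>. solves D (\<lambda>w. w) \<sigma> \<Sigma>))" for x
    unfolding P_def diophantine_free_with_length_def diophantine_problem_def \<pi>_def by (rule mem_Collect_eq)
  have Q_iff: "x \<in> Q \<longleftrightarrow> (\<exists>\<Sigma>. x = system_code \<nu> \<Sigma> \<and> system_over M (lists A) \<Sigma> \<and>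
      (\<exists>\<tau>. solves M \<iota> \<tau> \<Sigma>))" for x
    unfolding Q_def diophantine_problem_def \<nu>_def by (rule mem_Collect_eq)
  \<comment> \<open>backwards, the code of a solvable system over \<open>M\<close> can only come from a well-formed system\<close>
  have "x \<in> P \<longleftrightarrow> h x \<in> Q" for x
  proof
    assume "x \<in> P"
    then obtain \<Sigma> where \<Sigma>: "x = system_code \<pi> \<Sigma>" "system_over D (lists {..<n}) \<Sigma>" "\<exists>\<sigma>. solves D (\<lambda>w. w) \<sigma> \<Sigma>"
      unfolding P_iff by blast
    show "h x \<in> Q"
      unfolding Q_iff using wf[OF \<Sigma>(2)] \<Sigma>(1,3) by (intro exI[of _ "?tr \<Sigma>"] conjI) simp_all
  next
    assume "h x \<in> Q"
    then obtain \<Sigma>' where \<Sigma>': "h x = system_code \<nu> \<Sigma>'" "system_over M (lists A) \<Sigma>'" "\<exists>\<tau>. solves M \<iota> \<tau> \<Sigma>'"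
      unfolding Q_iff by blast
    obtain \<Sigma>\<^sub>0 where x: "x = system_code id \<Sigma>\<^sub>0"
      using surj_system_code by blast
    have "system_code id (translate_system id \<omega> (map \<nu> c) x \<Sigma>\<^sub>0) = system_code id (map (map_equation (map \<nu>)) \<Sigma>')"
      using \<Sigma>'(1) h[of \<Sigma>\<^sub>0] x by (simp only: system_code_map[of \<nu>])
    then have "translate_system id \<omega> (map \<nu> c) x \<Sigma>\<^sub>0 = map (map_equation (map \<nu>)) \<Sigma>'"
      by (rule injD[OF inj_system_code])
    moreover have "system_over M (lists {..<card A}) (map (map_equation (map \<nu>)) \<Sigma>')"
      using \<nu>(2) \<Sigma>'(2) by (intro system_over_map_equation[of \<nu> A]) simp_all
    ultimately have over: "system_over D (lists {..<n}) \<Sigma>\<^sub>0"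
      using translate_system_over_imp[of \<omega> "{..<card A}" id "map \<nu> c" x \<Sigma>\<^sub>0, OF assms(1) \<omega>_less] by simp
    define \<Sigma> where "\<Sigma> = map (map_equation (map (inv_into {..<n} \<pi>))) \<Sigma>\<^sub>0"
    have \<Sigma>: "system_over D (lists {..<n}) \<Sigma>"
      unfolding \<Sigma>_def
    proof (rule system_over_map_equation[OF _ over])
      show "inv_into {..<n} \<pi> ` {..<n} \<subseteq> {..<n}"
        using inv_into_into[of _ \<pi> "{..<n}"] \<pi>(2) by (intro image_subsetI) simp
    qed
    have "map (map_equation (map \<pi>)) \<Sigma> = \<Sigma>\<^sub>0"
      unfolding \<Sigma>_def using f_inv_into_f[of _ \<pi> "{..<n}"] \<pi>(2)
      by (intro map_equation_inverse[OF _ over]) simp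
    then have x': "x = system_code \<pi> \<Sigma>"
      using x by (simp only: system_code_map[of \<pi>])
    then have "system_code \<nu> \<Sigma>' = system_code \<nu> (?tr \<Sigma>)"
      using \<Sigma>'(1) wf(1)[OF \<Sigma>] by simp
    then have eq: "map (map_equation (map \<nu>)) \<Sigma>' = map (map_equation (map \<nu>)) (?tr \<Sigma>)"
      unfolding system_code_map[of \<nu>] by (rule injD[OF inj_system_code])
    have "map (map_equation (map (inv_into A \<nu>))) (map (map_equation (map \<nu>)) \<Phi>) = \<Phi>"
      if "system_over M (lists A) \<Phi>" for \<Phi>
      by (rule map_equation_inverse[OF _ that]) (rule inv_into_f_f[OF \<nu>(1)])
    from this[OF \<Sigma>'(2)] this[OF wf(3)[OF \<Sigma>]] have "\<Sigma>' = ?tr \<Sigma>"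
      unfolding eq by (rule HOL.trans[OF HOL.sym])
    then show "x \<in> P"
      unfolding P_iff using \<Sigma>'(3) wf(2)[OF \<Sigma>] \<Sigma> x' by (intro exI[of _ \<Sigma>] conjI) simp_all
  qed
  moreover have "computable Q 1 (\<lambda>xs. of_bool (h (xs ! 0) \<in> Q))"
  proof -
    have "computable Q 1 (\<lambda>xs. if xs ! 0 < n then T (xs ! 0) else symb_code id (Coef [card A]))"
      by (rule computable_finite_table)
    then have "computable Q 1 (\<lambda>xs. T (xs ! 0))"
      by (rule computable_cong) (simp add: T_def \<omega>_def)
    then show ?thesis
      unfolding h_def by (intro computable_oracle computable_code_translate_system)
  qed
  then obtain p where p: "\<And>xs. length xs = 1 \<Longrightarrow> rec_eval Q p xs (of_bool (h (xs ! 0) \<in> Q))"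
    unfolding computable_def by blast
  ultimately have "rec_eval Q p [x] (of_bool (x \<in> P))" for x
    using p[of "[x]"] by simp
  then show ?thesis
    unfolding turing_reducible_def P_def Q_def by blast
qed

end

section \<open>The theorem\<close>

lemma weighted_length_eq_sum_list:
  assumes "w \<in> lists {..<n}"
  shows "weighted_length n lam w = sum_list (map lam w)"
proof -
  have "sum_list (map lam w) = (\<Sum>i\<in>set w. count_list w i * lam i)"
    by (rule sum_list_map_eq_sum_count)
  also have "\<dots> = (\<Sum>i<n. count_list w i * lam i)"
    using assms by (intro sum.mono_neutral_left) (auto simp: in_lists_conv_set)
  finally show ?thesis
    by (simp add: weighted_length_def mult.commute)
qed

context branching_pieces
begin

lemma length_as_right_inverse_generators:
  assumes f: "bij_betw f {..<n} generators"
    and len: "\<And>w. w \<in> lists {..<n} \<Longrightarrow> len w = sum_list (map (snd \<circ> f) w)"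
  shows "length_as_right_inverse M (cls [a]) n (\<lambda>w. cls (concat (map (generator_word \<circ> f) w))) len"
proof -
  let ?g = "inv_into {..<n} f"
  have sub: "set (map f w) \<subseteq> generators" if "w \<in> lists {..<n}" for w
    using that bij_betwE[OF f] by (simp add: in_lists_conv_set image_subset_iff)
  have words: "concat (map (generator_word \<circ> f) w) \<in> lists A" if "w \<in> lists {..<n}" for w
    using concat_generator_words_lists[OF sub[OF that]] by simp
  have inj: "map ?g (map f w) = w" if "w \<in> lists {..<n}" for w
    using that bij_betw_inv_into_left[OF f] by (simp add: in_lists_conv_set map_idI)
  have surj: "map ?g ps \<in> lists {..<n} \<and> map f (map ?g ps) = ps" if "set ps \<subseteq> generators" for ps
  proof
    show "map ?g ps \<in> lists {..<n}"
      using that bij_betwE[OF bij_betw_inv_into[OF f]] by (force simp: in_lists_conv_set)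
    have "f (?g p) = p" if "p \<in> set ps" for p
      using that \<open>set ps \<subseteq> generators\<close> bij_betw_inv_into_right[OF f] by blast
    then show "map f (map ?g ps) = ps"
      by (simp add: map_idI)
  qed
  show ?thesis
  proof (intro length_as_right_inverse.intro length_as_right_inverse_axioms.intro)
    show "monoid M"
      by (rule M.monoid_axioms)
    show "cls [a] \<in> carrier M"
      using a_in_A by (intro cls_closed) simp
    show "\<exists>k::nat. x = cls [a] [^]\<^bsub>M\<^esub> k" if "x \<in> carrier M" "x \<otimes>\<^bsub>M\<^esub> cls [a] = cls [a] \<otimes>\<^bsub>M\<^esub> x" for x
      using that by (rule centralizer_of_a)
    show "i = j" if "cls [a] [^]\<^bsub>M\<^esub> (i::nat) = cls [a] [^]\<^bsub>M\<^esub> (j::nat)" for i j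
      using that by (rule inj_cls_a_pow)
    show "cls (concat (map (generator_word \<circ> f) w)) \<in> carrier M" if "w \<in> lists {..<n}" for w
      using words[OF that] by (rule cls_closed)
    show "cls (concat (map (generator_word \<circ> f) [])) = \<one>\<^bsub>M\<^esub>"
      by (simp add: one_M)
    show "cls (concat (map (generator_word \<circ> f) (u @ v)))
        = cls (concat (map (generator_word \<circ> f) u)) \<otimes>\<^bsub>M\<^esub> cls (concat (map (generator_word \<circ> f) v))"
      if "u \<in> lists {..<n}" "v \<in> lists {..<n}" for u v
      using words[OF that(1)] words[OF that(2)] by (simp add: mult_M)
    show "inj_on (\<lambda>w. cls (concat (map (generator_word \<circ> f) w))) (lists {..<n})"
    proof (rule inj_onI)
      fix u v
      assume uv: "u \<in> lists {..<n}" "v \<in> lists {..<n}"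
        "cls (concat (map (generator_word \<circ> f) u)) = cls (concat (map (generator_word \<circ> f) v))"
      have "map f u = map f v"
        using uv(3) by (intro generators_free sub uv(1,2)) simp
      from arg_cong[OF this, of "map ?g"] show "u = v"
        by (simp only: inj uv(1,2))
    qed
    fix y and k :: nat
    assume y: "y \<in> carrier M"
    show "cls [a] [^]\<^bsub>M\<^esub> k \<otimes>\<^bsub>M\<^esub> y = \<one>\<^bsub>M\<^esub> \<longleftrightarrow>
      (\<exists>w\<in>lists {..<n}. y = cls (concat (map (generator_word \<circ> f) w)) \<and> k = len w)" (is "?L \<longleftrightarrow> ?R")
    proof
      assume ?L
      then obtain ps where ps: "set ps \<subseteq> generators" "y = cls (concat (map generator_word ps))" "k = sum_list (map snd ps)"
        unfolding pow_a_right_inverse_iff[OF y] by blast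
      define w where "w = map ?g ps"
      have w: "w \<in> lists {..<n}" "map f w = ps"
        unfolding w_def using surj[OF ps(1)] by blast+
      then show ?R
        using ps(2,3) len[OF w(1)] by (intro bexI[of _ w]) (simp_all flip: w(2))
    next
      assume ?R
      then obtain w where w: "w \<in> lists {..<n}" "y = cls (concat (map (generator_word \<circ> f) w))" "k = len w"
        by (elim bexE conjE)
      then show ?L
        unfolding pow_a_right_inverse_iff[OF y] using sub[OF w(1)] len[OF w(1)]
        by (intro exI[of _ "map f w"]) simp
    qed
  qed
qed

theorem interpretable_and_reducible:
  assumes f: "bij_betw f {..<n} generators"
    and len: "\<And>w. w \<in> lists {..<n} \<Longrightarrow> len w = sum_list (map (snd \<circ> f) w)"
    and "finite A"
  shows "e_interpretable (free_monoid_with_length n len) M"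
    and "turing_reducible (diophantine_free_with_length n len) (diophantine_one_relator A r)"
proof -
  interpret L: length_as_right_inverse M "cls [a]" n "\<lambda>w. cls (concat (map (generator_word \<circ> f) w))" len
    using f len by (rule length_as_right_inverse_generators)
  show "e_interpretable (free_monoid_with_length n len) M"
    by (rule L.e_interpretable_in_M)
  show "turing_reducible (diophantine_free_with_length n len) (diophantine_one_relator A r)"
    unfolding diophantine_one_relator_def
  proof (rule L.diophantine_problem_reducible[of A "generator_word \<circ> f" _ "[a]"])
    show "rels M = []"
      by (simp add: one_relator_monoid_def presented_monoid_def)
    show "(generator_word \<circ> f) k \<in> lists A \<and>
        cls ((generator_word \<circ> f) k) = cls (concat (map (generator_word \<circ> f) [k]))" if "k < n" for k
      using generator_word_lists bij_betwE[OF f] that by simp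
  qed (use assms(3) a_in_A in simp_all)
qed

lemma weight_pos: "bij_betw f {..<n} generators \<Longrightarrow> i < n \<Longrightarrow> snd (f i) > 0"
  using bij_betwE[of f "{..<n}" generators] generatorsD(2)[of "fst (f i)" "snd (f i)"] by fastforce

lemma weight_one:
  assumes "\<And>w. w \<in> \<Delta> \<Longrightarrow> \<not> prefix [a, a] w" "(\<epsilon>, j) \<in> generators"
  shows "j = 1"
proof (rule ccontr)
  assume "j \<noteq> 1"
  then have "2 \<le> j"
    using generatorsD(2)[OF assms(2)] by simp
  then obtain m where "j = Suc (Suc m)"
    using le_Suc_ex[of 2 j] by auto
  then have "prefix [a, a] (replicate j a)"
    by simp
  then have "prefix [a, a] \<epsilon>"
    using assms(2) unfolding generators_def by (auto intro: prefix_order.trans)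
  then show False
    using assms generatorsD(1) by blast
qed

end

theorem theorem1:
  fixes A :: "'a set" and r :: "'a list" and rs :: "'a list list"
    and \<Delta> :: "'a list set" and a :: 'a and \<gamma> \<delta> :: "'a list"
  assumes "finite A" and "r \<in> lists A"
    and "minimal_invertible_decomposition A r rs"
    and "\<Delta> = set rs"
    and C1: "\<forall>u\<in>\<Delta>. \<forall>v\<in>\<Delta>. \<not> strict_sublist u v"
    and C2: "\<gamma> \<in> \<Delta>" "\<delta> \<in> \<Delta>" "\<gamma> \<noteq> \<delta>" "prefix [a] \<gamma>" "prefix [a] \<delta>"
  shows "(\<exists>n lam. n \<ge> 2 \<and> (\<forall>i<n. lam i > 0) \<and>
            e_interpretable (free_monoid_with_length n (weighted_length n lam)) (one_relator_monoid A r) \<and>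
            turing_reducible (diophantine_free_with_length n (weighted_length n lam))
              (diophantine_one_relator A r)) \<and>
         ((\<forall>w\<in>\<Delta>. \<not> prefix [a, a] w) \<longrightarrow>
          (\<exists>n. n \<ge> 2 \<and>
            e_interpretable (free_monoid_with_length n length) (one_relator_monoid A r) \<and>
            turing_reducible (diophantine_free_with_length n length)
              (diophantine_one_relator A r)))"
proof -
  interpret branching_pieces A r rs \<Delta> a \<gamma> \<delta>
    using assms by unfold_locales blast+
  \<comment> \<open>the free monoid has one letter for each generator, weighted by the exponent \<open>j\<close>\<close>
  define n where "n = card generators"
  obtain f where f: "bij_betw f {..<n} generators"
    using ex_bij_betw_nat_finite[OF finite_generators] unfolding n_def by (auto simp: atLeast0LessThan)
  have n: "n \<ge> 2"
    using card_generators by (simp add: n_def)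
  show ?thesis
  proof (intro conjI impI)
    show "\<exists>n lam. n \<ge> 2 \<and> (\<forall>i<n. lam i > 0) \<and>
        e_interpretable (free_monoid_with_length n (weighted_length n lam)) (one_relator_monoid A r) \<and>
        turing_reducible (diophantine_free_with_length n (weighted_length n lam)) (diophantine_one_relator A r)"
      using interpretable_and_reducible[OF f weighted_length_eq_sum_list assms(1)] n weight_pos[OF f]
      by (intro exI[of _ n] exI[of _ "snd \<circ> f"]) simp
    assume C3: "\<forall>w\<in>\<Delta>. \<not> prefix [a, a] w"
    have "length w = sum_list (map (snd \<circ> f) w)" if "w \<in> lists {..<n}" for w
    proof -
      have "(snd \<circ> f) i = 1" if "i < n" for i
        using weight_one[of "fst (f i)" "snd (f i)"] C3 bij_betwE[OF f] that by simp
      then have weights: "map (snd \<circ> f) w = map (\<lambda>_. 1) w"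
        using \<open>w \<in> lists {..<n}\<close> by (intro map_cong) (simp_all add: in_lists_conv_set)
      show ?thesis
        unfolding weights by (simp add: sum_list_triv)
    qed
    from interpretable_and_reducible[OF f this assms(1)] n
    show "\<exists>n. n \<ge> 2 \<and> e_interpretable (free_monoid_with_length n length) (one_relator_monoid A r) \<and>
        turing_reducible (diophantine_free_with_length n length) (diophantine_one_relator A r)"
      by (intro exI[of _ n]) simp
  qed
qed

end
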